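(* Let $(M,\mathcal T,F)$ be a pseudo-Finsler structure on a connected smooth manifold $M$. Then every isometry of $(M,\mathcal T,F)$ is a $C^\infty$-map, and it is completely determined by its second jet at any point of $M$; that is, if $f_1,f_2$ are isometries of $(M,\mathcal T,F)$ having the same second jet at some point $p\in M$, then $f_1=f_2$.
   Context: Let $M$ be a connected (finite-dimensional) smooth manifold and let $T_0M$ denote its tangent bundle $TM$ with the zero section removed. A pseudo-Finsler structure $(M,\mathcal T,F)$ on $M$ (also called a conic pseudo-Finsler structure) consists of an open subset $\mathcal T\subset T_0M$ and a smooth function $F:\mathcal T\to\mathbb R^+$ such that: (i) for all $p\in M$, $\mathcal T_p=\mathcal T\cap T_pM$ is a nonempty open cone of $T_pM$ (closed under multiplication by positive scalars); (ii) $F(tv)=tF(v)$ for all $v\in\mathcal T$ and $t>0$; (iii) for all $v\in\mathcal T$, the fundamental tensor $g_v=\left(\frac{\partial^2(F^2)}{\partial y_i\partial y_j}(v)\right)_{ij}$, i.e. the second derivative of $F^2$ at $v$ in the vertical (fiber) directions, is a nondegenerate symmetric bilinear form. An isometry of $(M,\mathcal T,F)$ is a diffeomorphism $f:M\to M$ of class $C^2$ with $\mathrm df(\mathcal T)=\mathcal T$ and $F\circ\mathrm df=F$ on $\mathcal T$. The second jet of $f$ at $p$ consists of the value of $f$ at $p$ together with its partial derivatives at $p$ (in local charts) up to order $2$. *)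

theory Defs
  imports "HOL-Analysis.Analysis"
begin

section \<open>Differentiability of class C^k on open subsets of normed spaces\<close>

(* Intended for open S. On a finite-dimensional domain, differentiability together with C^k
   directional derivatives in every fixed direction v is the usual notion of class C^(k+1);
   fixing v avoids iterating the type of the derivative. *)
fun Ck_on :: "nat \<Rightarrow> 'e::real_normed_vector set \<Rightarrow> ('e \<Rightarrow> 'f::real_normed_vector) \<Rightarrow> bool" where
  "Ck_on 0 S f \<longleftrightarrow> continuous_on S f"
| "Ck_on (Suc k) S f \<longleftrightarrow>
     (\<forall>x\<in>S. f differentiable (at x)) \<and> (\<forall>v. Ck_on k S (\<lambda>x. frechet_derivative f (at x) v))"

definition smooth_on :: "'e::real_normed_vector set \<Rightarrow> ('e \<Rightarrow> 'f::real_normed_vector) \<Rightarrow> bool" where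
  "smooth_on S f \<longleftrightarrow> (\<forall>k. Ck_on k S f)"

(* iter_deriv [v1, ..., vm] f is the iterated directional derivative D_v1 (... (D_vm f)). *)
fun iter_deriv :: "'e::real_normed_vector list \<Rightarrow> ('e \<Rightarrow> 'f::real_normed_vector) \<Rightarrow> 'e \<Rightarrow> 'f" where
  "iter_deriv [] f = f"
| "iter_deriv (v # vs) f = (\<lambda>x. frechet_derivative (iter_deriv vs f) (at x) v)"


section \<open>Smooth manifolds and maps between them\<close>

(* A chart (U, \<phi>) is a coordinate domain with a coordinate map; the values of \<phi> outside U
   are irrelevant. *)
type_synonym ('a, 'e) chart = "'a set \<times> ('a \<Rightarrow> 'e)"

abbreviation dom_chart :: "('a, 'e) chart \<Rightarrow> 'a set" where
  "dom_chart c \<equiv> fst c"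

abbreviation app_chart :: "('a, 'e) chart \<Rightarrow> 'a \<Rightarrow> 'e" where
  "app_chart c \<equiv> snd c"

definition inv_chart :: "('a, 'e) chart \<Rightarrow> 'e \<Rightarrow> 'a" where
  "inv_chart c = inv_into (dom_chart c) (app_chart c)"

definition coord_rep :: "('a, 'e) chart \<Rightarrow> ('b, 'f) chart \<Rightarrow> ('a \<Rightarrow> 'b) \<Rightarrow> 'e \<Rightarrow> 'f" where
  "coord_rep c d f = app_chart d \<circ> f \<circ> inv_chart c"

(* The atlas A need not be maximal: every notion below is unchanged when A is replaced by
   another atlas of the same smooth structure (for tangent vectors, up to the evident
   identification). *)
definition smooth_manifold :: "'a topology \<Rightarrow> ('a, 'e::euclidean_space) chart set \<Rightarrow> bool" where
  "smooth_manifold X A \<longleftrightarrow>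
     Hausdorff_space X \<and> second_countable X \<and>
     (\<Union>c\<in>A. dom_chart c) = topspace X \<and>
     (\<forall>c\<in>A. openin X (dom_chart c) \<and> open (app_chart c ` dom_chart c) \<and>
        homeomorphic_map (subtopology X (dom_chart c))
          (top_of_set (app_chart c ` dom_chart c)) (app_chart c)) \<and>
     (\<forall>c\<in>A. \<forall>d\<in>A. smooth_on (app_chart c ` (dom_chart c \<inter> dom_chart d)) (coord_rep c d id))"

definition Ck_map :: "nat \<Rightarrow> 'a topology \<Rightarrow> ('a, 'e::euclidean_space) chart set \<Rightarrow>
    'b topology \<Rightarrow> ('b, 'f::euclidean_space) chart set \<Rightarrow> ('a \<Rightarrow> 'b) \<Rightarrow> bool" where
  "Ck_map k X A Y B f \<longleftrightarrow>
     continuous_map X Y f \<and>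
     (\<forall>c\<in>A. \<forall>d\<in>B. Ck_on k (app_chart c ` (dom_chart c \<inter> f -` dom_chart d)) (coord_rep c d f))"

definition smooth_map :: "'a topology \<Rightarrow> ('a, 'e::euclidean_space) chart set \<Rightarrow>
    'b topology \<Rightarrow> ('b, 'f::euclidean_space) chart set \<Rightarrow> ('a \<Rightarrow> 'b) \<Rightarrow> bool" where
  "smooth_map X A Y B f \<longleftrightarrow> (\<forall>k. Ck_map k X A Y B f)"

definition Ck_diffeomorphism :: "nat \<Rightarrow> 'a topology \<Rightarrow> ('a, 'e::euclidean_space) chart set \<Rightarrow>
    'b topology \<Rightarrow> ('b, 'f::euclidean_space) chart set \<Rightarrow> ('a \<Rightarrow> 'b) \<Rightarrow> bool" where
  "Ck_diffeomorphism k X A Y B f \<longleftrightarrow>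
     bij_betw f (topspace X) (topspace Y) \<and>
     Ck_map k X A Y B f \<and> Ck_map k Y B X A (inv_into (topspace X) f)"

(* For C^k maps, agreement in one pair of charts implies agreement in all of them, by the
   chain rule. The empty list of directions gives the value. *)
definition same_jet :: "nat \<Rightarrow> ('a, 'e::euclidean_space) chart set \<Rightarrow>
    ('b, 'f::euclidean_space) chart set \<Rightarrow> 'a \<Rightarrow> ('a \<Rightarrow> 'b) \<Rightarrow> ('a \<Rightarrow> 'b) \<Rightarrow> bool" where
  "same_jet k A B p f g \<longleftrightarrow>
     f p = g p \<and>
     (\<exists>c\<in>A. \<exists>d\<in>B. p \<in> dom_chart c \<and> f p \<in> dom_chart d \<and>
        (\<forall>is. set is \<subseteq> Basis \<and> length is \<le> k \<longrightarrow>
           iter_deriv is (coord_rep c d f) (app_chart c p)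
             = iter_deriv is (coord_rep c d g) (app_chart c p)))"


section \<open>The tangent bundle\<close>

(* A tangent vector at p is the family of its coordinate vectors in all charts around p,
   related by the derivatives of the coordinate changes; by convention the family is 0 at
   every index that is not a chart around p. Vector space operations are componentwise. *)
type_synonym ('a, 'e) tangent = "'a \<times> (('a, 'e) chart \<Rightarrow> 'e)"

definition tangent_bundle :: "('a, 'e::euclidean_space) chart set \<Rightarrow> ('a, 'e) tangent set" where
  "tangent_bundle A = {(p, v). p \<in> (\<Union>c\<in>A. dom_chart c) \<and>
     (\<forall>c\<in>A. \<forall>d\<in>A. p \<in> dom_chart c \<inter> dom_chart d \<longrightarrow>
        v d = frechet_derivative (coord_rep c d id) (at (app_chart c p)) (v c)) \<and>
     (\<forall>c. \<not> (c \<in> A \<and> p \<in> dom_chart c) \<longrightarrow> v c = 0)}"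

definition scale_tangent :: "real \<Rightarrow> ('a, 'e::euclidean_space) tangent \<Rightarrow> ('a, 'e) tangent" where
  "scale_tangent t w = (fst w, \<lambda>c. t *\<^sub>R snd w c)"

definition slit_tangent_bundle :: "('a, 'e::euclidean_space) chart set \<Rightarrow> ('a, 'e) tangent set" where
  "slit_tangent_bundle A = {w \<in> tangent_bundle A. snd w \<noteq> (\<lambda>c. 0)}"

definition tangent_chart ::
    "('a, 'e::euclidean_space) chart set \<Rightarrow> ('a, 'e) chart \<Rightarrow> (('a, 'e) tangent, 'e \<times> 'e) chart" where
  "tangent_chart A c =
     ({w \<in> tangent_bundle A. fst w \<in> dom_chart c}, \<lambda>w. (app_chart c (fst w), snd w c))"

definition tangent_atlas ::
    "('a, 'e::euclidean_space) chart set \<Rightarrow> (('a, 'e) tangent, 'e \<times> 'e) chart set" where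
  "tangent_atlas A = tangent_chart A ` A"

definition atlas_topology :: "('a, 'e::euclidean_space) chart set \<Rightarrow> 'a topology" where
  "atlas_topology A = topology (\<lambda>W. W \<subseteq> (\<Union>c\<in>A. dom_chart c) \<and>
     (\<forall>c\<in>A. open (app_chart c ` (W \<inter> dom_chart c))))"

lemma openin_atlas_topology:
  assumes inj: "\<And>c. c \<in> A \<Longrightarrow> inj_on (app_chart c) (dom_chart c)"
  shows "openin (atlas_topology A) W \<longleftrightarrow> W \<subseteq> (\<Union>c\<in>A. dom_chart c) \<and>
     (\<forall>c\<in>A. open (app_chart c ` (W \<inter> dom_chart c)))"
proof -
  have "istopology (\<lambda>W. W \<subseteq> (\<Union>c\<in>A. dom_chart c) \<and>
     (\<forall>c\<in>A. open (app_chart c ` (W \<inter> dom_chart c))))"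
    unfolding istopology_def
  proof (intro conjI allI impI ballI; (elim conjE)?)
    fix S T c
    assume S: "\<forall>c\<in>A. open (app_chart c ` (S \<inter> dom_chart c))"
      and T: "\<forall>c\<in>A. open (app_chart c ` (T \<inter> dom_chart c))" and c: "c \<in> A"
    have "app_chart c ` ((S \<inter> T) \<inter> dom_chart c)
        = app_chart c ` (S \<inter> dom_chart c) \<inter> app_chart c ` (T \<inter> dom_chart c)"
      using inj_on_image_Int[OF inj[OF c], of "S \<inter> dom_chart c" "T \<inter> dom_chart c"]
      by (simp add: Int_ac)
    then show "open (app_chart c ` ((S \<inter> T) \<inter> dom_chart c))"
      using S T c by auto
  next
    fix K c
    assume K: "\<forall>W\<in>K. W \<subseteq> (\<Union>c\<in>A. dom_chart c) \<and>
        (\<forall>c\<in>A. open (app_chart c ` (W \<inter> dom_chart c)))" and c: "c \<in> A"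
    have "app_chart c ` (\<Union>K \<inter> dom_chart c) = (\<Union>W\<in>K. app_chart c ` (W \<inter> dom_chart c))"
      by blast
    then show "open (app_chart c ` (\<Union>K \<inter> dom_chart c))"
      using K c by auto
  qed auto
  then show ?thesis
    unfolding atlas_topology_def by (simp add: topology_inverse')
qed

lemma inj_on_tangent_chart:
  assumes "inj_on (app_chart c) (dom_chart c)" "c \<in> A"
  shows "inj_on (app_chart (tangent_chart A c)) (dom_chart (tangent_chart A c))"
proof (rule inj_onI)
  fix w w'
  assume w: "w \<in> dom_chart (tangent_chart A c)" and w': "w' \<in> dom_chart (tangent_chart A c)"
    and eq: "app_chart (tangent_chart A c) w = app_chart (tangent_chart A c) w'"
  have p: "fst w = fst w'"
    using assms(1) w w' eq by (auto simp: tangent_chart_def inj_on_def)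
  obtain q v where wq: "w = (q, v)" by (cases w)
  obtain v' where wq': "w' = (q, v')" using p wq by (cases w') simp
  have mem: "(q, v) \<in> tangent_bundle A" "(q, v') \<in> tangent_bundle A" "q \<in> dom_chart c"
    and vc: "v c = v' c"
    using w w' eq wq wq' by (simp_all add: tangent_chart_def)
  have "v d = v' d" for d
  proof (cases "d \<in> A \<and> q \<in> dom_chart d")
    case True
    have "u d = frechet_derivative (coord_rep c d id) (at (app_chart c q)) (u c)"
      if "(q, u) \<in> tangent_bundle A" for u
      using that True assms(2) mem(3) unfolding tangent_bundle_def by blast
    from this[OF mem(1)] this[OF mem(2)] show ?thesis by (simp only: vc)
  next
    case False
    have "u d = 0" if "(q, u) \<in> tangent_bundle A" for u
      using that False unfolding tangent_bundle_def by blast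
    from this[OF mem(1)] this[OF mem(2)] show ?thesis by (simp only:)
  qed
  then show "w = w'" using wq wq' by (simp add: fun_eq_iff)
qed

lemma openin_tangent_topology:
  assumes "smooth_manifold X A"
  shows "openin (atlas_topology (tangent_atlas A)) W \<longleftrightarrow> W \<subseteq> tangent_bundle A \<and>
     (\<forall>c\<in>A. open (app_chart (tangent_chart A c) ` (W \<inter> dom_chart (tangent_chart A c))))"
proof -
  have inj: "inj_on (app_chart c) (dom_chart c)" if "c \<in> A" for c
  proof -
    have "openin X (dom_chart c)"
      "homeomorphic_map (subtopology X (dom_chart c))
        (top_of_set (app_chart c ` dom_chart c)) (app_chart c)"
      using assms that by (auto simp: smooth_manifold_def)
    then show ?thesis
      by (simp add: homeomorphic_map_def Int_absorb1[OF openin_subset])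
  qed
  have "(\<Union>c\<in>tangent_atlas A. dom_chart c) = tangent_bundle A"
  proof
    show "tangent_bundle A \<subseteq> (\<Union>c\<in>tangent_atlas A. dom_chart c)"
    proof
      fix w assume w: "w \<in> tangent_bundle A"
      then have "fst w \<in> (\<Union>c\<in>A. dom_chart c)"
        unfolding tangent_bundle_def by (simp only: case_prod_unfold mem_Collect_eq)
      then show "w \<in> (\<Union>c\<in>tangent_atlas A. dom_chart c)"
        using w by (auto simp: tangent_atlas_def tangent_chart_def)
    qed
  qed (auto simp: tangent_atlas_def tangent_chart_def)
  moreover have "inj_on (app_chart c) (dom_chart c)" if "c \<in> tangent_atlas A" for c
    using that unfolding tangent_atlas_def
    by (elim imageE) (simp only: inj_on_tangent_chart[OF inj])
  ultimately show ?thesis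
    by (subst openin_atlas_topology) (auto simp: tangent_atlas_def)
qed

(* By the chain rule the result does not depend on the chart c chosen around the base point. *)
definition tangent_map :: "('a, 'e::euclidean_space) chart set \<Rightarrow>
    ('b, 'f::euclidean_space) chart set \<Rightarrow> ('a \<Rightarrow> 'b) \<Rightarrow> ('a, 'e) tangent \<Rightarrow> ('b, 'f) tangent" where
  "tangent_map A B f w =
     (let p = fst w; c = (SOME c. c \<in> A \<and> p \<in> dom_chart c) in
      (f p, \<lambda>d. if d \<in> B \<and> f p \<in> dom_chart d
                then frechet_derivative (coord_rep c d f) (at (app_chart c p)) (snd w c)
                else 0))"


section \<open>Pseudo-Finsler structures and their isometries\<close>

(* Smoothness of a real function on an open subset W of the manifold with atlas A. *)
definition smooth_function_on ::
    "('a, 'e::euclidean_space) chart set \<Rightarrow> 'a set \<Rightarrow> ('a \<Rightarrow> real) \<Rightarrow> bool" where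
  "smooth_function_on A W F \<longleftrightarrow>
     (\<forall>c\<in>A. smooth_on (app_chart c ` (W \<inter> dom_chart c)) (F \<circ> inv_chart c))"

(* The coordinate expression of g_w in the chart c: with F read as a function F(x, y) of the
   induced coordinates of TM, and w having coordinates (x, y), this is the second derivative
   of y |-> F(x, y)^2 in the fibre directions a, b. On basis vectors it is the matrix
   of second partial derivatives in y. *)
definition fundamental_tensor :: "('a, 'e::euclidean_space) chart set \<Rightarrow>
    (('a, 'e) tangent \<Rightarrow> real) \<Rightarrow> ('a, 'e) chart \<Rightarrow> ('a, 'e) tangent \<Rightarrow> 'e \<Rightarrow> 'e \<Rightarrow> real" where
  "fundamental_tensor A F c w a b =
     iter_deriv [a, b] (\<lambda>y. (F (inv_chart (tangent_chart A c) (app_chart c (fst w), y)))\<^sup>2)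
       (snd w c)"

definition nondegenerate_symmetric_bilinear :: "('e::euclidean_space \<Rightarrow> 'e \<Rightarrow> real) \<Rightarrow> bool" where
  "nondegenerate_symmetric_bilinear g \<longleftrightarrow>
     bilinear g \<and> (\<forall>a b. g a b = g b a) \<and> (\<forall>a. (\<forall>b. g a b = 0) \<longrightarrow> a = 0)"

(* Each fibre of T is open in its tangent space because T is open in TM. *)
definition pseudo_finsler :: "('a, 'e::euclidean_space) chart set \<Rightarrow> ('a, 'e) tangent set \<Rightarrow>
    (('a, 'e) tangent \<Rightarrow> real) \<Rightarrow> bool" where
  "pseudo_finsler A T F \<longleftrightarrow>
     T \<subseteq> slit_tangent_bundle A \<and> openin (atlas_topology (tangent_atlas A)) T \<and>
     smooth_function_on (tangent_atlas A) T F \<and> (\<forall>w\<in>T. F w > 0) \<and>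
     (\<forall>p\<in>(\<Union>c\<in>A. dom_chart c). \<exists>w\<in>T. fst w = p) \<and>
     (\<forall>w\<in>T. \<forall>t>0. scale_tangent t w \<in> T) \<and>
     (\<forall>w\<in>T. \<forall>t>0. F (scale_tangent t w) = t * F w) \<and>
     (\<forall>w\<in>T. \<forall>c\<in>A. fst w \<in> dom_chart c \<longrightarrow>
        nondegenerate_symmetric_bilinear (fundamental_tensor A F c w))"

definition finsler_isometry :: "'a topology \<Rightarrow> ('a, 'e::euclidean_space) chart set \<Rightarrow>
    ('a, 'e) tangent set \<Rightarrow> (('a, 'e) tangent \<Rightarrow> real) \<Rightarrow> ('a \<Rightarrow> 'a) \<Rightarrow> bool" where
  "finsler_isometry X A T F f \<longleftrightarrow>
     Ck_diffeomorphism 2 X A X A f \<and>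
     tangent_map A A f ` T = T \<and> (\<forall>w\<in>T. F (tangent_map A A f w) = F w)"

end

theory Submission
  imports Defs
begin

text \<open>
  In a chart, the square L of F is a function L(x, y) on an open set of positions x and
  velocities y whose Hessian in y is nondegenerate. For such a regular Lagrangian the
  Euler-Lagrange equation can be solved for the acceleration: there is exactly one vector
  S(x, y), the value of the spray, with D(D_y L)(x, y)(y, S(x, y)) = D_x L(x, y), and S is smooth
  because it solves a linear system with smooth coefficients (\<open>Ck_on_linear_solution\<close>,
  \<open>smooth_on_spray\<close>).

  An isometry f satisfies L'(f(x), Df(x) y) = L(x, y). Differentiating this identity once in x, and
  once in y and then along the direction (y, S(x, y)), and comparing the results shows that
  f carries sprays to sprays (\<open>spray_transforms\<close>):

    D^2 f(x)(y, y) = S'(f(x), Df(x) y) - Df(x) S(x, y).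

  No third derivative of f and no integration of geodesics is involved; besides the chain rule,
  only the symmetry of D^2 f is used. The admissible y at a given x form a nonempty open
  set, so the quadratic form D^2 f(x) is recovered from its values on them by
  polarization, and D^2 f is expressed through x, f and Df by smooth functions.

  Both claims follow from this closed second-order system. If f is of class C^(k+1), the right-hand side is of
  class C^k, so f is of class C^(k+2) (\<open>Ck_on_bootstrap\<close>), and f is smooth by induction.
  If f and g agree at a point together with their first derivatives, then the system
  bounds D^2(f - g) near that point by a multiple of |f - g| + |D(f - g)|, which forces f = g
  nearby (\<open>local_isometry_unique\<close>). On a connected manifold the interior of the set where f and g
  agree is then open, closed and nonempty, hence everything.
\<close>

section \<open>Directional derivatives and the calculus of class C^k\<close>

abbreviation dd :: "'e::real_normed_vector \<Rightarrow> ('e \<Rightarrow> 'f::real_normed_vector) \<Rightarrow> 'e \<Rightarrow> 'f" where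
  "dd v f x \<equiv> frechet_derivative f (at x) v"

lemma linear_expand_Basis:
  fixes g :: "'e::euclidean_space \<Rightarrow> 'f::real_vector"
  assumes "linear g"
  shows "g v = (\<Sum>b\<in>Basis. (v \<bullet> b) *\<^sub>R g b)"
proof -
  have "g (\<Sum>b\<in>Basis. (v \<bullet> b) *\<^sub>R b) = (\<Sum>b\<in>Basis. (v \<bullet> b) *\<^sub>R g b)"
    using assms by (simp add: linear_sum linear_cmul)
  then show ?thesis by (simp add: euclidean_representation)
qed

lemma norm_linear_le_Basis:
  fixes f :: "'e::euclidean_space \<Rightarrow> 'f::real_normed_vector"
  assumes "linear f"
  shows "norm (f u) \<le> (\<Sum>b\<in>Basis. norm (f b)) * norm u"
proof -
  have "f u = (\<Sum>b\<in>Basis. (u \<bullet> b) *\<^sub>R f b)" by (rule linear_expand_Basis[OF assms])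
  also have "norm \<dots> \<le> (\<Sum>b\<in>Basis. norm ((u \<bullet> b) *\<^sub>R f b))" by (rule norm_sum)
  also have "\<dots> \<le> (\<Sum>b\<in>Basis. norm (f b) * norm u)"
  proof (rule sum_mono)
    fix b :: 'e assume "b \<in> Basis"
    from mult_right_mono[OF Basis_le_norm[OF this, of u] norm_ge_zero[of "f b"]]
    show "norm ((u \<bullet> b) *\<^sub>R f b) \<le> norm (f b) * norm u" by (simp add: mult.commute)
  qed
  finally show ?thesis by (simp add: sum_distrib_right)
qed

lemma isCont_tendsto_nhds: "isCont f x \<Longrightarrow> (f \<longlongrightarrow> f x) (nhds x)"
  by (metis continuous_at tendsto_at_iff_tendsto_nhds)

lemma dd_eqI: "(f has_derivative f') (at x) \<Longrightarrow> dd v f x = f' v"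
  by (metis frechet_derivative_at)

lemma has_derivative_dd: "f differentiable (at x) \<Longrightarrow> (f has_derivative (\<lambda>v. dd v f x)) (at x)"
  using frechet_derivative_works by blast

lemma has_derivative_cong_open:
  assumes "open S" "x \<in> S" "\<And>y. y \<in> S \<Longrightarrow> f y = g y"
  shows "(f has_derivative f') (at x) \<longleftrightarrow> (g has_derivative f') (at x)"
  by (metis assms has_derivative_transform_within_open)

lemma differentiable_cong_open:
  assumes "open S" "x \<in> S" "\<And>y. y \<in> S \<Longrightarrow> f y = g y"
  shows "f differentiable (at x) \<longleftrightarrow> g differentiable (at x)"
  unfolding differentiable_def using has_derivative_cong_open[OF assms(1,2), of f g] assms(3) by simp

lemma dd_cong_open:
  assumes "open S" "x \<in> S" "\<And>y. y \<in> S \<Longrightarrow> f y = g y"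
  shows "dd v f x = dd v g x"
  unfolding frechet_derivative_def using has_derivative_cong_open[OF assms(1,2), of f g] assms(3) by simp

lemma linear_dd: "f differentiable (at x) \<Longrightarrow> linear (\<lambda>v. dd v f x)"
  using linear_frechet_derivative by auto

lemma dd_expand:
  fixes f :: "'e::euclidean_space \<Rightarrow> 'f::real_normed_vector"
  assumes "f differentiable (at x)"
  shows "dd v f x = (\<Sum>b\<in>Basis. (v \<bullet> b) *\<^sub>R dd b f x)"
  by (rule linear_expand_Basis[OF linear_dd[OF assms]])

lemma Ck_on_cong:
  assumes "open S" "\<And>x. x \<in> S \<Longrightarrow> f x = g x"
  shows "Ck_on k S f \<longleftrightarrow> Ck_on k S g"
  using assms(2)
proof (induction k arbitrary: f g)
  case 0
  have "continuous_on S f \<longleftrightarrow> continuous_on S g"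
    by (rule continuous_on_cong[OF refl]) (rule 0)
  then show ?case by (simp only: Ck_on.simps)
next
  case (Suc k)
  have 1: "f differentiable (at x) \<longleftrightarrow> g differentiable (at x)" if "x \<in> S" for x
    by (rule differentiable_cong_open[OF assms(1) that]) (rule Suc.prems)
  have "Ck_on k S (dd v f) \<longleftrightarrow> Ck_on k S (dd v g)" for v
    by (rule Suc.IH, rule dd_cong_open[OF assms(1)]) (simp_all add: Suc.prems)
  with 1 show ?case by auto
qed

lemma Ck_on_transform:
  "Ck_on k S f \<Longrightarrow> (\<And>x. x \<in> S \<Longrightarrow> f x = g x) \<Longrightarrow> open S \<Longrightarrow> Ck_on k S g"
  using Ck_on_cong[of S f g k] by simp

lemma Ck_on_SucD: "Ck_on (Suc k) S f \<Longrightarrow> Ck_on k S f"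
proof (induction k arbitrary: f)
  case 0
  then show ?case
    by (simp add: continuous_at_imp_continuous_on differentiable_imp_continuous_within)
next
  case (Suc k)
  then show ?case by (metis Ck_on.simps(2))
qed

lemma Ck_on_subset: "Ck_on k S f \<Longrightarrow> T \<subseteq> S \<Longrightarrow> Ck_on k T f"
  by (induction k arbitrary: f) (auto intro: continuous_on_subset)

text \<open>Each clause in the definition of \<open>Ck_on\<close> concerns neighbourhoods of single points.\<close>

lemma Ck_on_local:
  assumes "\<And>x. x \<in> S \<Longrightarrow> \<exists>U. open U \<and> x \<in> U \<and> Ck_on k U f"
  shows "Ck_on k S f"
  using assms
proof (induction k arbitrary: f)
  case 0
  then have "isCont f x" if "x \<in> S" for x
    using that by (metis Ck_on.simps(1) continuous_on_eq_continuous_at)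
  then show ?case by (simp add: continuous_at_imp_continuous_on)
next
  case (Suc k)
  have "Ck_on k S (dd v f)" for v
    using Suc.IH Suc.prems by (metis Ck_on.simps(2))
  then show ?case using Suc.prems by (metis Ck_on.simps(2))
qed

text \<open>The derivative is usually found as an explicit formula valid on the open set only; this rule lets
  the induction on k run on that formula instead of \<open>frechet_derivative\<close>.\<close>

lemma Ck_on_SucI:
  assumes "open S"
    and "\<And>x. x \<in> S \<Longrightarrow> (f has_derivative f' x) (at x)"
    and "\<And>v. Ck_on k S (\<lambda>x. f' x v)"
  shows "Ck_on (Suc k) S f"
proof -
  have "Ck_on k S (dd v f)" for v
    using Ck_on_cong[OF assms(1), of "dd v f" "\<lambda>x. f' x v" k] assms(3) dd_eqI[OF assms(2)] by simp
  with assms(2) show ?thesis by (auto simp: differentiable_def)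
qed

lemma Ck_on_SucE:
  assumes "Ck_on (Suc k) S f" "x \<in> S"
  shows "(f has_derivative (\<lambda>v. dd v f x)) (at x)"
  using assms has_derivative_dd by auto

lemma Ck_on_dd: "Ck_on (Suc k) S f \<Longrightarrow> Ck_on k S (dd v f)"
  by simp

lemma Ck_on_const: "Ck_on k S (\<lambda>x. c)"
  by (induction k arbitrary: c) auto

lemma Ck_on_bounded_linear:
  assumes "bounded_linear h" "open S"
  shows "Ck_on k S f \<Longrightarrow> Ck_on k S (\<lambda>x. h (f x))"
proof (induction k arbitrary: f)
  case 0
  then show ?case using assms(1) by (simp add: bounded_linear.continuous_on)
next
  case (Suc k)
  show ?case
    by (rule Ck_on_SucI[OF assms(2) bounded_linear.has_derivative[OF assms(1) Ck_on_SucE[OF Suc.prems]]])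
      (use Suc in auto)
qed

lemma Ck_on_linear_fun:
  assumes "bounded_linear h" "open S"
  shows "Ck_on k S h"
proof (cases k)
  case 0
  then show ?thesis using assms(1) by (simp add: linear_continuous_on)
next
  case (Suc j)
  show ?thesis unfolding Suc
    by (rule Ck_on_SucI[OF assms(2) bounded_linear_imp_has_derivative[OF assms(1)]])
      (rule Ck_on_const)
qed

lemma Ck_on_add:
  assumes "open S"
  shows "Ck_on k S f \<Longrightarrow> Ck_on k S g \<Longrightarrow> Ck_on k S (\<lambda>x. f x + g x)"
proof (induction k arbitrary: f g)
  case 0
  then show ?case by (simp add: continuous_on_add)
next
  case (Suc k)
  show ?case
    by (rule Ck_on_SucI[OF assms has_derivative_add[OF Ck_on_SucE[OF Suc.prems(1)] Ck_on_SucE[OF Suc.prems(2)]]])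
      (use Suc in auto)
qed

lemma Ck_on_diff:
  assumes "open S" "Ck_on k S f" "Ck_on k S g"
  shows "Ck_on k S (\<lambda>x. f x - g x)"
  using Ck_on_add[OF assms(1,2) Ck_on_bounded_linear[OF _ assms(1,3), of "\<lambda>x. - x"]]
  by (simp add: bounded_linear_minus[OF bounded_linear_ident])

lemma Ck_on_sum:
  assumes "open S" "\<And>i. i \<in> I \<Longrightarrow> Ck_on k S (f i)"
  shows "Ck_on k S (\<lambda>x. \<Sum>i\<in>I. f i x)"
  using assms(2)
  by (induction I rule: infinite_finite_induct) (auto simp: Ck_on_const intro!: Ck_on_add[OF assms(1)])

lemma Ck_on_bilinear:
  assumes "bounded_bilinear p" "open S"
  shows "Ck_on k S f \<Longrightarrow> Ck_on k S g \<Longrightarrow> Ck_on k S (\<lambda>x. p (f x) (g x))"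
proof (induction k arbitrary: f g)
  case 0
  then show ?case by (simp add: bounded_bilinear.continuous_on[OF assms(1)])
next
  case (Suc k)
  note f = Ck_on_SucD[OF Suc.prems(1)] and g = Ck_on_SucD[OF Suc.prems(2)]
  show ?case
    by (rule Ck_on_SucI[OF assms(2) bounded_bilinear.FDERIV[OF assms(1) Ck_on_SucE[OF Suc.prems(1)] Ck_on_SucE[OF Suc.prems(2)]]])
      (use Suc f g in \<open>auto intro!: Ck_on_add[OF assms(2)] Suc.IH\<close>)
qed

lemma Ck_on_Pair:
  assumes "open S" "Ck_on k S f" "Ck_on k S g"
  shows "Ck_on k S (\<lambda>x. (f x, g x))"
proof -
  have "bounded_linear (\<lambda>a::'b. (a, 0::'c))" "bounded_linear (\<lambda>a::'c. (0::'b, a))"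
    by (auto intro!: bounded_linear_Pair bounded_linear_ident bounded_linear_zero)
  from Ck_on_add[OF assms(1) Ck_on_bounded_linear[OF this(1) assms(1,2)] Ck_on_bounded_linear[OF this(2) assms(1,3)]]
  show ?thesis by simp
qed

text \<open>The chain rule, with the derivative of the outer function expanded over a basis so that only
  fixed directions occur and the induction hypothesis applies to each summand.\<close>

lemma Ck_on_compose:
  fixes f :: "'d::real_normed_vector \<Rightarrow> 'e::euclidean_space" and g :: "'e \<Rightarrow> 'f::real_normed_vector"
  assumes "open S" "f ` S \<subseteq> U"
  shows "Ck_on k S f \<Longrightarrow> Ck_on k U g \<Longrightarrow> Ck_on k S (\<lambda>x. g (f x))"
proof (induction k arbitrary: g)
  case 0
  then show ?case using assms by (auto intro: continuous_on_compose2)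
next
  case (Suc k)
  have der: "((\<lambda>x. g (f x)) has_derivative (\<lambda>v. \<Sum>b\<in>Basis. (dd v f x \<bullet> b) *\<^sub>R dd b g (f x))) (at x)"
    if "x \<in> S" for x
  proof -
    have "g differentiable at (f x)" using Suc.prems assms(2) that by auto
    moreover have "((\<lambda>x. g (f x)) has_derivative (\<lambda>v. dd (dd v f x) g (f x))) (at x)"
      using has_derivative_compose[OF Ck_on_SucE[OF Suc.prems(1) that] Ck_on_SucE[OF Suc.prems(2)]]
        assms(2) that by auto
    ultimately show ?thesis by (simp add: dd_expand[of g "f x" "dd _ f x"])
  qed
  note f = Ck_on_SucD[OF Suc.prems(1)]
  have "Ck_on k S (\<lambda>x. \<Sum>b\<in>Basis. (dd v f x \<bullet> b) *\<^sub>R dd b g (f x))" for v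
    using Suc.prems f
    by (intro Ck_on_sum Ck_on_bilinear[OF bounded_bilinear_scaleR] Suc.IH
        Ck_on_bounded_linear[OF bounded_linear_inner_left] Ck_on_dd assms(1)) auto
  from Ck_on_SucI[OF assms(1) der this] show ?case .
qed

lemma Ck_on_frechet_derivative_fun:
  fixes f :: "'e::euclidean_space \<Rightarrow> 'f::real_normed_vector"
  assumes "open S" "Ck_on (Suc k) S f" "Ck_on k S g"
  shows "Ck_on k S (\<lambda>x. dd (g x) f x)"
proof -
  have 1: "Ck_on k S (\<lambda>x. \<Sum>b\<in>Basis. (g x \<bullet> b) *\<^sub>R dd b f x)"
    using assms(2,3)
    by (intro Ck_on_sum Ck_on_bilinear[OF bounded_bilinear_scaleR]
        Ck_on_bounded_linear[OF bounded_linear_inner_left] Ck_on_dd assms(1)) auto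
  have "(\<Sum>b\<in>Basis. (g x \<bullet> b) *\<^sub>R dd b f x) = dd (g x) f x" if "x \<in> S" for x
    using dd_expand[of f x "g x"] assms(2) that by auto
  from Ck_on_transform[OF 1 this assms(1)] show ?thesis .
qed

section \<open>Linear systems with C^k coefficients\<close>

text \<open>With N the inverse of the matrix at the base point, r = N(b - M s(z0)) is the candidate for the
  increment of the solution: N M differs from the identity by o(1), so the increment
  s - s(z0) differs from r by a small fraction of itself, hence of r. The point is that r
  involves s only through the constant s(z0), so continuity or differentiability of M and b passes to r
  and from there to s.\<close>

lemma linear_solution_estimate:
  fixes M :: "'z::real_normed_vector \<Rightarrow> 'e::euclidean_space \<Rightarrow> 'e"
  assumes S: "open S" "z0 \<in> S"
    and lin: "\<And>z. z \<in> S \<Longrightarrow> linear (M z)"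
    and inj: "inj (M z0)"
    and M: "\<And>u. isCont (\<lambda>z. M z u) z0"
    and eq: "\<And>z. z \<in> S \<Longrightarrow> M z (s z) = b z"
  shows "\<exists>N. bounded_linear N \<and> (\<forall>e>0. \<forall>\<^sub>F z in nhds z0.
    norm (s z - s z0 - N (b z - M z (s z0))) \<le> e * norm (N (b z - M z (s z0))))"
proof -
  obtain N where N: "linear N" "N \<circ> M z0 = id"
    using linear_injective_left_inverse[OF lin[OF S(2)] inj] by blast
  have NM: "N (M z0 u) = u" for u using N(2) by (simp add: pointfree_idE)
  define \<eta> where "\<eta> z = (\<Sum>i\<in>Basis. norm (i - N (M z i)))" for z
  have blN: "bounded_linear N" using N(1) by (simp add: linear_conv_bounded_linear)
  have key: "norm (s z - s z0 - N (b z - M z (s z0))) \<le> \<eta> z * norm (s z - s z0)" if "z \<in> S" for z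
  proof -
    have l: "linear (\<lambda>u. u - N (M z u))"
      using linear_compose_sub[OF linear_id linear_compose[OF lin[OF that] N(1)]]
      by (simp add: o_def id_def)
    have "N (M z (s z - s z0)) = N (b z - M z (s z0))"
      by (simp add: linear_diff[OF lin[OF that]] eq[OF that])
    then show ?thesis
      using norm_linear_le_Basis[OF l, of "s z - s z0"] by (simp add: \<eta>_def)
  qed
  have cont: "isCont \<eta> z0"
    unfolding \<eta>_def by (intro continuous_intros bounded_linear.isCont[OF blN] M)
  have "\<eta> z0 = 0" using NM by (simp add: \<eta>_def)
  with cont have "(\<eta> \<longlongrightarrow> 0) (nhds z0)"
    using isCont_tendsto_nhds by metis
  then have \<eta>: "\<forall>\<^sub>F z in nhds z0. z \<in> S \<and> \<eta> z < e" if "e > 0" for e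
    using order_tendstoD(2) that eventually_nhds_in_open[OF S] by (metis eventually_conj)
  have 1: "\<forall>\<^sub>F z in nhds z0. norm (s z - s z0 - N (b z - M z (s z0))) \<le> e * norm (s z - s z0)"
    if "e > 0" for e
    using \<eta>[OF that]
  proof eventually_elim
    case (elim z)
    then have "\<eta> z * norm (s z - s z0) \<le> e * norm (s z - s z0)" by (intro mult_right_mono) auto
    with key[of z] elim show ?case by simp
  qed
  have 2: "\<forall>\<^sub>F z in nhds z0. norm (s z - s z0 - N (b z - M z (s z0))) \<le> e * norm (N (b z - M z (s z0)))"
    if e: "e > 0" for e
  proof -
    (* c <= 1/2 gives |d| <= 2 |r|, and c <= e/2 then turns c |d| into e |r|. *)
    define c where "c = min (1 / 2) (e / 2)"
    have c: "c > 0" "c \<le> 1 / 2" "c \<le> e / 2" using e by (auto simp: c_def)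
    show ?thesis using 1[OF c(1)]
    proof eventually_elim
      case (elim z)
      let ?d = "s z - s z0" and ?r = "N (b z - M z (s z0))"
      have "norm ?d \<le> norm (?d - ?r) + norm ?r"
        by (metis diff_add_cancel norm_triangle_ineq)
      moreover have "c * norm ?d \<le> 1 / 2 * norm ?d" using c(2) by (intro mult_right_mono) auto
      ultimately have "norm ?d \<le> 2 * norm ?r" using elim by simp
      then have "c * norm ?d \<le> (e / 2) * (2 * norm ?r)" using c e by (intro mult_mono) auto
      then show ?case using elim by simp
    qed
  qed
  show ?thesis using blN 2 by (intro exI[of _ N]) simp
qed

lemma isCont_linear_solution:
  fixes M :: "'z::real_normed_vector \<Rightarrow> 'e::euclidean_space \<Rightarrow> 'e"
  assumes "open S" "z0 \<in> S"
    and "\<And>z. z \<in> S \<Longrightarrow> linear (M z)"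
    and "inj (M z0)"
    and M: "\<And>u. isCont (\<lambda>z. M z u) z0"
    and b: "isCont b z0"
    and eq: "\<And>z. z \<in> S \<Longrightarrow> M z (s z) = b z"
  shows "isCont s z0"
proof -
  obtain N where N: "bounded_linear N"
    and est: "\<And>e. e > 0 \<Longrightarrow> \<forall>\<^sub>F z in nhds z0. norm (s z - s z0 - N (b z - M z (s z0))) \<le> e * norm (N (b z - M z (s z0)))"
    using linear_solution_estimate[OF assms(1-5) eq] by blast
  define r where "r z = N (b z - M z (s z0))" for z
  have "isCont r z0" unfolding r_def
    by (intro bounded_linear.isCont[OF N] continuous_intros b M)
  moreover have "r z0 = 0"
    using eq[OF assms(2)] by (simp add: r_def linear_simps[OF N])
  ultimately have r: "(r \<longlongrightarrow> 0) (at z0)" by (simp add: continuous_at)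
  have "\<forall>\<^sub>F z in at z0. norm (s z - s z0) \<le> norm (r z) * 2"
  proof -
    have "\<forall>\<^sub>F z in nhds z0. norm (s z - s z0) \<le> norm (r z) * 2"
    proof -
      have "\<forall>\<^sub>F z in nhds z0. norm (s z - s z0 - r z) \<le> 1 * norm (r z)"
        using est[of 1] by (simp add: r_def)
      then show ?thesis
      proof eventually_elim
        case (elim z)
        then show ?case using norm_triangle_ineq[of "s z - s z0 - r z" "r z"] by simp
      qed
    qed

    then show ?thesis by (simp add: eventually_nhds_conv_at)
  qed
  from Lim_null_comparison[OF this] r have "((\<lambda>z. s z - s z0) \<longlongrightarrow> 0) (at z0)"
    by (simp add: tendsto_mult_left_zero tendsto_norm_zero)
  then show ?thesis by (simp add: continuous_at LIM_zero_iff)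
qed

lemma differentiable_linear_solution:
  fixes M :: "'z::real_normed_vector \<Rightarrow> 'e::euclidean_space \<Rightarrow> 'e"
  assumes S: "open S" "z0 \<in> S"
    and lin: "\<And>z. z \<in> S \<Longrightarrow> linear (M z)"
    and inj: "inj (M z0)"
    and M: "\<And>u. (\<lambda>z. M z u) differentiable (at z0)"
    and b: "b differentiable (at z0)"
    and eq: "\<And>z. z \<in> S \<Longrightarrow> M z (s z) = b z"
  shows "s differentiable (at z0)"
proof -
  obtain N where N: "bounded_linear N"
    and est: "\<And>e. e > 0 \<Longrightarrow> \<forall>\<^sub>F z in nhds z0. norm (s z - s z0 - N (b z - M z (s z0))) \<le> e * norm (N (b z - M z (s z0)))"
    using linear_solution_estimate[OF S lin inj differentiable_imp_continuous_within[OF M] eq] by blast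
  define r where "r z = N (b z - M z (s z0))" for z
  have "r z0 = 0" using eq[OF S(2)] by (simp add: r_def linear_simps[OF N])
  obtain q where "((\<lambda>z. b z - M z (s z0)) has_derivative q) (at z0)"
    using differentiable_diff[OF b M] unfolding differentiable_def by blast
  then obtain r' where r': "(r has_derivative r') (at z0)"
    unfolding r_def using bounded_linear.has_derivative[OF N] by blast
  then have blr: "bounded_linear r'" by (rule has_derivative_bounded_linear)
  obtain B where B: "B > 0" "\<And>x. norm (r' x) \<le> norm x * B"
    using bounded_linear.pos_bounded[OF blr] by blast
  have "(s has_derivative r') (at z0)"
    unfolding has_derivative_at_alt
  proof (intro conjI allI impI blr)
    fix e :: real assume e: "e > 0"
    define C where "C = B + e / 2"
    have C: "C > 0" using B e by (simp add: C_def)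
    obtain d1 where d1: "d1 > 0" "\<And>z. norm (z - z0) < d1 \<Longrightarrow> norm (r z - r z0 - r' (z - z0)) \<le> e / 2 * norm (z - z0)"
      using r' e unfolding has_derivative_at_alt by (metis half_gt_zero)
    obtain d2 where d2: "d2 > 0"
      "\<And>z. dist z z0 < d2 \<Longrightarrow> norm (s z - s z0 - r z) \<le> e / (2 * C) * norm (r z)"
      using est[of "e / (2 * C)"] e C unfolding eventually_nhds_metric r_def by auto
    have "norm (s z - s z0 - r' (z - z0)) \<le> e * norm (z - z0)" if z: "norm (z - z0) < min d1 d2" for z
    proof -
      have z1: "norm (r z - r' (z - z0)) \<le> e / 2 * norm (z - z0)"
        using d1(2)[of z] z \<open>r z0 = 0\<close> by simp
      have "norm (r z) \<le> norm (r z - r' (z - z0)) + norm (r' (z - z0))"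
        by (metis diff_add_cancel norm_triangle_ineq)
      then have rz: "norm (r z) \<le> C * norm (z - z0)"
        using z1 B(2)[of "z - z0"] by (simp add: C_def algebra_simps)
      have "norm (s z - s z0 - r z) \<le> e / (2 * C) * norm (r z)"
        using d2(2)[of z] z by (simp add: dist_norm)
      also have "\<dots> \<le> e / (2 * C) * (C * norm (z - z0))"
        using rz e C by (intro mult_left_mono) auto
      also have "\<dots> = e / 2 * norm (z - z0)" using C by simp
      finally have "norm (s z - s z0 - r z) \<le> e / 2 * norm (z - z0)" .
      moreover have "norm (s z - s z0 - r' (z - z0)) \<le> norm (s z - s z0 - r z) + norm (r z - r' (z - z0))"
        using norm_triangle_ineq[of "s z - s z0 - r z" "r z - r' (z - z0)"] by simp
      ultimately show ?thesis using z1 by simp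
    qed
    then show "\<exists>d>0. \<forall>z. norm (z - z0) < d \<longrightarrow> norm (s z - s z0 - r' (z - z0)) \<le> e * norm (z - z0)"
      using d1 d2 by (metis min_less_iff_conj)
  qed
  then show ?thesis by (auto simp: differentiable_def)
qed

text \<open>Differentiating M s = b in the direction v gives a system with the same matrix,
  M (D_v s) = D_v b - (D_v M) s, whose right-hand side involves s but no derivative of s.
  Hence it is of class C^k if s is and M and b are of class C^(k+1), and then so is D_v s by
  induction, which starts from continuity.\<close>

lemma Ck_on_linear_solution:
  fixes M :: "'z::real_normed_vector \<Rightarrow> 'e::euclidean_space \<Rightarrow> 'e"
  assumes S: "open S"
    and lin: "\<And>z. z \<in> S \<Longrightarrow> linear (M z)"
    and inj: "\<And>z. z \<in> S \<Longrightarrow> inj (M z)"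
  shows "(\<And>u. Ck_on k S (\<lambda>z. M z u)) \<Longrightarrow> Ck_on k S b \<Longrightarrow>
    (\<And>z. z \<in> S \<Longrightarrow> M z (s z) = b z) \<Longrightarrow> Ck_on k S s"
proof (induction k arbitrary: b s)
  case 0
  have "isCont s z" if "z \<in> S" for z
    by (rule isCont_linear_solution[of S z M b s])
      (use 0 that S lin inj in \<open>auto simp: continuous_on_eq_continuous_at\<close>)
  then show ?case by (simp add: continuous_at_imp_continuous_on)
next
  case (Suc k)
  have s: "Ck_on k S s"
    by (rule Suc.IH[of b]) (use Suc.prems in \<open>auto intro: Ck_on_SucD simp del: Ck_on.simps\<close>)
  have ds: "s differentiable (at z)" if "z \<in> S" for z
    by (rule differentiable_linear_solution[of S z M b s])
      (use Suc.prems that S lin inj in auto)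
  have "Ck_on k S (dd v s)" for v
  proof (rule Suc.IH[of "\<lambda>z. dd v b z - (\<Sum>i\<in>Basis. (s z \<bullet> i) *\<^sub>R dd v (\<lambda>z. M z i) z)"])
    show "Ck_on k S (\<lambda>z. M z u)" for u using Suc.prems(1) Ck_on_SucD by blast
    show "Ck_on k S (\<lambda>z. dd v b z - (\<Sum>i\<in>Basis. (s z \<bullet> i) *\<^sub>R dd v (\<lambda>z. M z i) z))"
      by (intro Ck_on_diff Ck_on_sum Ck_on_bilinear[OF bounded_bilinear_scaleR] S
          Ck_on_bounded_linear[OF bounded_linear_inner_left] s Ck_on_dd Suc.prems)
    fix z assume z: "z \<in> S"
    have expand: "M y u = (\<Sum>i\<in>Basis. (u \<bullet> i) *\<^sub>R M y i)" if "y \<in> S" for y u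
      by (rule linear_expand_Basis[OF lin[OF that]])
    have eq: "b y = (\<Sum>i\<in>Basis. (s y \<bullet> i) *\<^sub>R M y i)" if "y \<in> S" for y
      using expand[OF that, of "s y"] by (simp only: Suc.prems(3)[OF that])
    have "((\<lambda>y. \<Sum>i\<in>Basis. (s y \<bullet> i) *\<^sub>R M y i) has_derivative
        (\<lambda>v. \<Sum>i\<in>Basis. (s z \<bullet> i) *\<^sub>R dd v (\<lambda>z. M z i) z + (dd v s z \<bullet> i) *\<^sub>R M z i)) (at z)"
      by (intro has_derivative_sum has_derivative_scaleR has_derivative_inner_left
          has_derivative_dd[OF ds[OF z]] Ck_on_SucE[OF Suc.prems(1) z])
    from dd_cong_open[OF S z eq, where v=v] dd_eqI[OF this, where v=v]
    have "dd v b z = (\<Sum>i\<in>Basis. (s z \<bullet> i) *\<^sub>R dd v (\<lambda>z. M z i) z + (dd v s z \<bullet> i) *\<^sub>R M z i)"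
      by (rule trans)
    then show "M z (dd v s z) = dd v b z - (\<Sum>i\<in>Basis. (s z \<bullet> i) *\<^sub>R dd v (\<lambda>z. M z i) z)"
      by (simp add: sum.distrib expand[OF z, of "dd v s z"])
  qed
  then show ?case using ds by auto
qed

section \<open>Second derivatives: symmetry and polarization\<close>

lemma has_real_derivative_along_line:
  fixes f :: "'e::real_normed_vector \<Rightarrow> real"
  assumes "f differentiable (at (x + s *\<^sub>R v))"
  shows "((\<lambda>s. f (x + s *\<^sub>R v)) has_real_derivative dd v f (x + s *\<^sub>R v)) (at s)"
proof -
  have "((\<lambda>s. x + s *\<^sub>R v) has_derivative (\<lambda>t. t *\<^sub>R v)) (at s)"
    by (auto intro!: derivative_eq_intros)
  from has_derivative_compose[OF this has_derivative_dd[OF assms]]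
  have "((\<lambda>s. f (x + s *\<^sub>R v)) has_derivative (\<lambda>t. dd (t *\<^sub>R v) f (x + s *\<^sub>R v))) (at s)" .
  moreover have "(\<lambda>t. dd (t *\<^sub>R v) f (x + s *\<^sub>R v)) = (*) (dd v f (x + s *\<^sub>R v))"
    using linear_cmul[OF linear_dd[OF assms]] by (auto simp: mult.commute)
  ultimately show ?thesis by (simp add: has_field_derivative_def)
qed

text \<open>The second difference is symmetric in v and w, while applying the mean value theorem first in v and then in w
  produces the derivatives in that order.\<close>

lemma second_difference_mvt:
  fixes f :: "'e::real_normed_vector \<Rightarrow> real"
  assumes f: "Ck_on 2 S f" and h: "h > 0"
    and mem: "\<And>s t. 0 \<le> s \<Longrightarrow> s \<le> h \<Longrightarrow> 0 \<le> t \<Longrightarrow> t \<le> h \<Longrightarrow> x + s *\<^sub>R v + t *\<^sub>R w \<in> S"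
  shows "\<exists>s t. 0 < s \<and> s < h \<and> 0 < t \<and> t < h \<and>
    f (x + h *\<^sub>R v + h *\<^sub>R w) - f (x + h *\<^sub>R v) - f (x + h *\<^sub>R w) + f x
      = h * h * dd w (dd v f) (x + s *\<^sub>R v + t *\<^sub>R w)"
proof -
  have d1: "f differentiable (at y)" and d2: "dd v f differentiable (at y)" if "y \<in> S" for y
    using f that by (auto simp: numeral_2_eq_2)
  define g where "g s = f (x + h *\<^sub>R w + s *\<^sub>R v) - f (x + s *\<^sub>R v)" for s
  have "(g has_real_derivative dd v f (x + h *\<^sub>R w + s *\<^sub>R v) - dd v f (x + s *\<^sub>R v)) (at s)"
    if "0 \<le> s" "s \<le> h" for s
    unfolding g_def using mem[of s h] mem[of s 0] that h
    by (intro DERIV_diff has_real_derivative_along_line d1) (auto simp: algebra_simps)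
  from MVT2[OF h, of g, OF this] obtain s where s: "0 < s" "s < h"
    "g h - g 0 = h * (dd v f (x + h *\<^sub>R w + s *\<^sub>R v) - dd v f (x + s *\<^sub>R v))" by auto
  define k where "k t = dd v f (x + s *\<^sub>R v + t *\<^sub>R w)" for t
  have "(k has_real_derivative dd w (dd v f) (x + s *\<^sub>R v + t *\<^sub>R w)) (at t)"
    if "0 \<le> t" "t \<le> h" for t
    unfolding k_def using mem[of s t] that s(1,2)
    by (intro has_real_derivative_along_line d2) auto
  from MVT2[OF h, of k, OF this] obtain t where t: "0 < t" "t < h"
    "k h - k 0 = h * dd w (dd v f) (x + s *\<^sub>R v + t *\<^sub>R w)" by auto
  have "g h - g 0 = h * (k h - k 0)"
    using s(3) by (simp add: k_def algebra_simps)
  then have "g h - g 0 = h * h * dd w (dd v f) (x + s *\<^sub>R v + t *\<^sub>R w)"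
    using t(3) by simp
  then show ?thesis using s t by (intro exI[of _ s] exI[of _ t]) (simp add: g_def algebra_simps)
qed

lemma dd_commute_real:
  fixes f :: "'e::real_normed_vector \<Rightarrow> real"
  assumes S: "open S" "x \<in> S" and f: "Ck_on 2 S f"
  shows "dd v (dd w f) x = dd w (dd v f) x"
proof (rule ccontr)
  assume ne: "dd v (dd w f) x \<noteq> dd w (dd v f) x"
  define e where "e = \<bar>dd v (dd w f) x - dd w (dd v f) x\<bar> / 2"
  have e: "e > 0" using ne by (simp add: e_def)
  have c: "isCont (dd v (dd w f)) x" "isCont (dd w (dd v f)) x"
    using f S by (auto simp: numeral_2_eq_2 continuous_on_eq_continuous_at)
  have "\<forall>\<^sub>F y in nhds x. y \<in> S \<and> \<bar>dd v (dd w f) y - dd v (dd w f) x\<bar> < e \<and> \<bar>dd w (dd v f) y - dd w (dd v f) x\<bar> < e"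
    using eventually_nhds_in_open[OF S] tendstoD[OF c(1)[THEN isCont_tendsto_nhds] e]
      tendstoD[OF c(2)[THEN isCont_tendsto_nhds] e]
    by eventually_elim (simp add: dist_real_def)
  then obtain \<delta> where \<delta>: "\<delta> > 0" "\<And>y. dist y x < \<delta> \<Longrightarrow> y \<in> S \<and> \<bar>dd v (dd w f) y - dd v (dd w f) x\<bar> < e \<and> \<bar>dd w (dd v f) y - dd w (dd v f) x\<bar> < e"
    unfolding eventually_nhds_metric by blast
  define h where "h = \<delta> / (2 * (norm v + norm w + 1))"
  have pos: "norm v + norm w + 1 > 0" by (metis add_nonneg_pos norm_ge_zero zero_less_one add_nonneg_nonneg)
  have h: "h > 0" using \<delta>(1) pos by (simp add: h_def)
  have hs: "h * (norm v + norm w) < \<delta>"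
  proof -
    have "h * (norm v + norm w) \<le> h * (norm v + norm w + 1)" using h by (intro mult_left_mono) auto
    also have "\<dots> = \<delta> / 2"
    proof -
      have "\<delta> / (2 * D) * D = \<delta> / 2" if "D > 0" for D using that by simp
      from this[OF pos] show ?thesis by (simp only: h_def)
    qed
    finally show ?thesis using \<delta>(1) by simp
  qed
  have close: "dist (x + s *\<^sub>R v + t *\<^sub>R w) x < \<delta>" if "0 \<le> s" "s \<le> h" "0 \<le> t" "t \<le> h" for s t
  proof -
    have "dist (x + s *\<^sub>R v + t *\<^sub>R w) x \<le> s * norm v + t * norm w"
      using norm_triangle_ineq[of "s *\<^sub>R v" "t *\<^sub>R w"] that by (simp add: dist_norm add.assoc)
    also have "\<dots> \<le> h * norm v + h * norm w" using that by (intro add_mono mult_right_mono) auto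
    finally show ?thesis using hs by (simp add: algebra_simps)
  qed
  obtain s t where st: "0 < s" "s < h" "0 < t" "t < h" "f (x + h *\<^sub>R v + h *\<^sub>R w) - f (x + h *\<^sub>R v) - f (x + h *\<^sub>R w) + f x
      = h * h * dd w (dd v f) (x + s *\<^sub>R v + t *\<^sub>R w)"
    using second_difference_mvt[OF f h, of x v w] close \<delta>(2) by blast
  have close': "dist (x + s *\<^sub>R w + t *\<^sub>R v) x < \<delta>" if "0 \<le> s" "s \<le> h" "0 \<le> t" "t \<le> h" for s t
    using close[of t s] that by (simp add: algebra_simps)
  obtain s' t' where st': "0 < s'" "s' < h" "0 < t'" "t' < h" "f (x + h *\<^sub>R w + h *\<^sub>R v) - f (x + h *\<^sub>R w) - f (x + h *\<^sub>R v) + f x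
      = h * h * dd v (dd w f) (x + s' *\<^sub>R w + t' *\<^sub>R v)"
    using second_difference_mvt[OF f h, of x w v] close' \<delta>(2) by blast
  have "h * h * dd v (dd w f) (x + s' *\<^sub>R w + t' *\<^sub>R v) = h * h * dd w (dd v f) (x + s *\<^sub>R v + t *\<^sub>R w)"
  proof -
    have "x + h *\<^sub>R w + h *\<^sub>R v = x + h *\<^sub>R v + h *\<^sub>R w" by (simp add: add.commute add.left_commute)
    then have "f (x + h *\<^sub>R w + h *\<^sub>R v) = f (x + h *\<^sub>R v + h *\<^sub>R w)" by (rule arg_cong)
    then show ?thesis using st(5) st'(5) by linarith
  qed
  then have "dd v (dd w f) (x + s' *\<^sub>R w + t' *\<^sub>R v) = dd w (dd v f) (x + s *\<^sub>R v + t *\<^sub>R w)" using h by simp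
  moreover have "\<bar>dd v (dd w f) (x + s' *\<^sub>R w + t' *\<^sub>R v) - dd v (dd w f) x\<bar> < e"
    using \<delta>(2)[OF close'] st' by simp
  moreover have "\<bar>dd w (dd v f) (x + s *\<^sub>R v + t *\<^sub>R w) - dd w (dd v f) x\<bar> < e"
    using \<delta>(2)[OF close] st by simp
  ultimately show False unfolding e_def by argo
qed

lemma dd_bounded_linear:
  assumes "bounded_linear h" "f differentiable (at x)"
  shows "dd v (\<lambda>x. h (f x)) x = h (dd v f x)"
  using dd_eqI[OF bounded_linear.has_derivative[OF assms(1) has_derivative_dd[OF assms(2)]]] .

lemma dd_commute:
  fixes f :: "'e::real_normed_vector \<Rightarrow> 'f::real_inner"
  assumes S: "open S" "x \<in> S" and f: "Ck_on 2 S f"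
  shows "dd v (dd w f) x = dd w (dd v f) x"
proof -
  have 1: "dd v (dd w (\<lambda>x. f x \<bullet> b)) x = dd v (dd w f) x \<bullet> b" for v w b
  proof -
    have "dd w (\<lambda>x. f x \<bullet> b) y = dd w f y \<bullet> b" if "y \<in> S" for y
      using f that by (intro dd_bounded_linear[OF bounded_linear_inner_left]) (simp add: numeral_2_eq_2)
    from dd_cong_open[OF S this] have "dd v (dd w (\<lambda>x. f x \<bullet> b)) x = dd v (\<lambda>x. dd w f x \<bullet> b) x" .
    also have "\<dots> = dd v (dd w f) x \<bullet> b"
      using f S by (intro dd_bounded_linear[OF bounded_linear_inner_left]) (simp add: numeral_2_eq_2)
    finally show ?thesis .
  qed
  have "dd v (dd w f) x \<bullet> b = dd w (dd v f) x \<bullet> b" for b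
    unfolding 1[symmetric]
    by (rule dd_commute_real[OF S Ck_on_bounded_linear[OF bounded_linear_inner_left S(1) f]])
  then show ?thesis by (metis vector_eq_rdot)
qed

lemma bilinear_dd_dd:
  assumes S: "open S" "x \<in> S" and f: "Ck_on 2 S f"
  shows "bilinear (\<lambda>v w. dd v (dd w f) x)"
proof -
  have d1: "f differentiable (at y)" and d2: "dd w f differentiable (at y)" if "y \<in> S" for y w
    using f that by (auto simp: numeral_2_eq_2)
  have "linear (\<lambda>w. dd v (dd w f) x)" for v
  proof (rule linearI)
    fix w1 w2
    have "dd (w1 + w2) f y = dd w1 f y + dd w2 f y" if "y \<in> S" for y
      using linear_add[OF linear_dd[OF d1[OF that]]] .
    from dd_cong_open[OF S this, where v=v]
      dd_eqI[OF has_derivative_add[OF has_derivative_dd[OF d2[OF S(2)]] has_derivative_dd[OF d2[OF S(2)]]], where v=v]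
    show "dd v (dd (w1 + w2) f) x = dd v (dd w1 f) x + dd v (dd w2 f) x" by simp
  next
    fix c w
    have "dd (c *\<^sub>R w) f y = c *\<^sub>R dd w f y" if "y \<in> S" for y
      using linear_cmul[OF linear_dd[OF d1[OF that]]] .
    from dd_cong_open[OF S this, where v=v]
    show "dd v (dd (c *\<^sub>R w) f) x = c *\<^sub>R dd v (dd w f) x"
      using dd_bounded_linear[OF bounded_linear_scaleR_right d2[OF S(2)]] by simp
  qed
  then show ?thesis unfolding bilinear_def using linear_dd[OF d2[OF S(2)]] by blast
qed

lemma polarization:
  assumes "bilinear B" and sym: "\<And>v w. B v w = B w v"
  shows "2 *\<^sub>R B v w = B (y + v + w) (y + v + w) - B (y + v) (y + v) - B (y + w) (y + w) + B y y"
  using sym[of w v] sym[of v y] sym[of w y]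
  by (simp add: bilinear_ladd[OF assms(1)] bilinear_radd[OF assms(1)] scaleR_2)

text \<open>Polarization needs the diagonal values of a bilinear map at four points only, and scaling the two
  directions moves these points into any given neighbourhood.\<close>

lemma polarization_points:
  fixes A :: "'e::real_normed_vector set"
  assumes "open A" "y \<in> A"
  shows "\<exists>c>0. y + c *\<^sub>R v + c *\<^sub>R w \<in> A \<and> y + c *\<^sub>R v \<in> A \<and> y + c *\<^sub>R w \<in> A"
proof -
  have lim: "\<forall>\<^sub>F c in at_right 0. g c \<in> A" if "isCont g (0::real)" "g 0 = y" for g
  proof -
    have "(g \<longlongrightarrow> y) (at_right 0)"
      using that(1) unfolding continuous_at that(2) by (rule tendsto_mono[OF at_le[OF subset_UNIV]])
    then show ?thesis using assms topological_tendstoD by blast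
  qed
  have "\<forall>\<^sub>F c in at_right 0. y + c *\<^sub>R v + c *\<^sub>R w \<in> A" "\<forall>\<^sub>F c in at_right 0. y + c *\<^sub>R v \<in> A"
    "\<forall>\<^sub>F c in at_right 0. y + c *\<^sub>R w \<in> A"
    by (intro lim; simp)+
  then have "\<forall>\<^sub>F c in at_right (0::real). c > 0 \<and> y + c *\<^sub>R v + c *\<^sub>R w \<in> A \<and> y + c *\<^sub>R v \<in> A \<and> y + c *\<^sub>R w \<in> A"
    using eventually_at_right_less[of "0::real"] by eventually_elim simp
  then show ?thesis using eventually_happens'[OF trivial_limit_at_right_real] by blast
qed

section \<open>Uniqueness from a differential inequality\<close>

lemma C1_locally_Lipschitz:
  fixes G :: "'e::euclidean_space \<Rightarrow> 'f::real_normed_vector"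
  assumes U: "open U" "z0 \<in> U" and G: "Ck_on 1 U G"
  shows "\<exists>K\<ge>0. \<exists>r>0. \<forall>z\<in>ball z0 r. \<forall>z'\<in>ball z0 r. norm (G z - G z') \<le> K * norm (z - z')"
proof -
  define K where "K = (\<Sum>b\<in>Basis. norm (dd b G z0) + 1)"
  have "\<forall>\<^sub>F z in nhds z0. norm (dd b G z) < norm (dd b G z0) + 1" for b
  proof -
    have "isCont (\<lambda>z. norm (dd b G z)) z0"
      using G U by (auto simp: continuous_on_eq_continuous_at intro: continuous_norm)
    from order_tendstoD(2)[OF isCont_tendsto_nhds[OF this]] show ?thesis by simp
  qed
  then have "\<forall>\<^sub>F z in nhds z0. \<forall>b\<in>Basis. norm (dd b G z) < norm (dd b G z0) + 1"
    by (simp add: eventually_ball_finite)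
  then have "\<forall>\<^sub>F z in nhds z0. z \<in> U \<and> (\<forall>b\<in>Basis. norm (dd b G z) < norm (dd b G z0) + 1)"
    using eventually_nhds_in_open[OF U] by eventually_elim simp
  then obtain r where r: "r > 0" "\<And>z. dist z z0 < r \<Longrightarrow> z \<in> U \<and> (\<forall>b\<in>Basis. norm (dd b G z) < norm (dd b G z0) + 1)"
    unfolding eventually_nhds_metric by blast
  have diff: "G differentiable (at z)" if "z \<in> ball z0 r" for z
    using G r(2)[of z] that by (auto simp: dist_commute)
  have "norm (G z - G z') \<le> K * norm (z - z')" if z: "z \<in> ball z0 r" "z' \<in> ball z0 r" for z z'
  proof (rule differentiable_bound[OF convex_ball _ _ z])
    fix y assume y: "y \<in> ball z0 r"
    show "(G has_derivative (\<lambda>v. dd v G y)) (at y within ball z0 r)"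
      using has_derivative_dd[OF diff[OF y]] has_derivative_at_withinI by blast
    show "onorm (\<lambda>v. dd v G y) \<le> K"
    proof (rule onorm_le)
      fix v
      have "norm (dd v G y) \<le> (\<Sum>b\<in>Basis. norm (dd b G y)) * norm v"
        by (rule norm_linear_le_Basis[OF linear_dd[OF diff[OF y]]])
      also have "\<dots> \<le> K * norm v"
        unfolding K_def using r(2)[of y] y
        by (intro mult_right_mono sum_mono) (auto simp: dist_commute less_imp_le)
      finally show "norm (dd v G y) \<le> K * norm v" .
    qed
  qed
  moreover have "K \<ge> 0" by (simp add: K_def sum_nonneg)
  ultimately show ?thesis using r(1) by blast
qed

text \<open>On a ball of radius r let m be the maximum of the sum of the norms. The mean value inequality
  bounds each function by K m r, so m is at most (card I) K r m, and m = 0 once r is small.\<close>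

lemma vanish_of_linear_differential_inequality:
  fixes h :: "'i \<Rightarrow> 'e::euclidean_space \<Rightarrow> 'f::real_normed_vector"
  assumes I: "finite I" and zero: "\<And>i. i \<in> I \<Longrightarrow> h i x0 = 0"
    and ev: "\<forall>\<^sub>F x in nhds x0. \<forall>i\<in>I. h i differentiable (at x) \<and>
      (\<forall>w. norm (dd w (h i) x) \<le> K * (\<Sum>j\<in>I. norm (h j x)) * norm w)"
  shows "\<forall>\<^sub>F x in nhds x0. \<forall>i\<in>I. h i x = 0"
proof -
  define N where "N x = (\<Sum>j\<in>I. norm (h j x))" for x
  have N0: "N x \<ge> 0" for x by (simp add: N_def sum_nonneg)
  (* C exceeds both |K| card I and 0, so that 1 / (2 C) makes sense as a radius. *)
  define C where "C = \<bar>K\<bar> * (real (card I) + 1) + 1"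
  have C: "C > 0" by (simp add: C_def add_nonneg_pos)
  obtain d where d: "d > 0" "\<And>x i. dist x x0 < d \<Longrightarrow> i \<in> I \<Longrightarrow> h i differentiable (at x)"
    "\<And>x i w. dist x x0 < d \<Longrightarrow> i \<in> I \<Longrightarrow> norm (dd w (h i) x) \<le> K * N x * norm w"
    using ev unfolding eventually_nhds_metric N_def by blast
  define r where "r = min (d / 2) (1 / (2 * C))"
  have r: "r > 0" "r < d" "r * C \<le> 1 / 2" using d(1) C by (auto simp: r_def min_def field_simps)
  have in_d: "dist x x0 < d" if "x \<in> cball x0 r" for x using that r by (simp add: dist_commute)
  have "continuous_on (cball x0 r) N"
    unfolding N_def
    using d(2)[OF in_d] by (intro continuous_intros continuous_at_imp_continuous_on ballI
        differentiable_imp_continuous_within) auto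
  then obtain m where m: "m \<in> cball x0 r" "\<And>x. x \<in> cball x0 r \<Longrightarrow> N x \<le> N m"
    using continuous_attains_sup[of "cball x0 r" N] r(1) by auto
  have bound: "norm (h i x) \<le> \<bar>K\<bar> * N m * r" if x: "x \<in> cball x0 r" and i: "i \<in> I" for x i
  proof -
    have "norm (h i x - h i x0) \<le> \<bar>K\<bar> * N m * norm (x - x0)"
    proof (rule differentiable_bound[OF convex_cball _ _ x])
      show "x0 \<in> cball x0 r" using r(1) by simp
      fix y assume y: "y \<in> cball x0 r"
      show "(h i has_derivative (\<lambda>v. dd v (h i) y)) (at y within cball x0 r)"
        using has_derivative_dd[OF d(2)[OF in_d[OF y] i]] has_derivative_at_withinI by blast
      show "onorm (\<lambda>v. dd v (h i) y) \<le> \<bar>K\<bar> * N m"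
      proof (rule onorm_le)
        fix v
        have "norm (dd v (h i) y) \<le> K * N y * norm v" using d(3)[OF in_d[OF y] i] .
        also have "\<dots> \<le> \<bar>K\<bar> * N m * norm v"
          using m(2)[OF y] N0 by (intro mult_right_mono mult_mono) auto
        finally show "norm (dd v (h i) y) \<le> \<bar>K\<bar> * N m * norm v" .
      qed
    qed
    also have "\<dots> \<le> \<bar>K\<bar> * N m * r"
      using x N0 by (intro mult_left_mono) (auto simp: dist_norm norm_minus_commute)
    finally show ?thesis using zero[OF i] by simp
  qed
  have "N m \<le> (\<Sum>i\<in>I. \<bar>K\<bar> * N m * r)"
    unfolding N_def by (rule sum_mono) (use bound[OF m(1)] in \<open>simp add: N_def\<close>)
  also have "\<dots> = (\<bar>K\<bar> * real (card I)) * (N m * r)" by simp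
  also have "\<dots> \<le> C * (N m * r)"
    using N0 r(1) by (intro mult_right_mono) (auto simp: C_def algebra_simps)
  also have "\<dots> = (r * C) * N m" by simp
  also have "\<dots> \<le> 1 / 2 * N m" using r(3) N0 by (intro mult_right_mono)
  finally have "N m = 0" using N0[of m] by simp
  then have "h i x = 0" if "x \<in> cball x0 r" "i \<in> I" for x i
    using bound[OF that] by simp
  then show ?thesis
    unfolding eventually_nhds_metric using r(1) by (intro exI[of _ r]) (auto simp: dist_commute)
qed

section \<open>The spray of a regular Lagrangian\<close>

lemma smooth_on_Ck: "smooth_on S f \<Longrightarrow> Ck_on k S f"
  by (simp add: smooth_on_def)

lemma smooth_on_dd: "smooth_on S f \<Longrightarrow> smooth_on S (dd v f)"
  unfolding smooth_on_def by (metis Ck_on.simps(2))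

lemma smooth_on_differentiable: "smooth_on S f \<Longrightarrow> x \<in> S \<Longrightarrow> f differentiable (at x)"
  unfolding smooth_on_def by (metis Ck_on.simps(2))

text \<open>The last clause says that the Hessian of L in the fibre variable is nondegenerate.\<close>

definition regular_Lagrangian :: "('e::euclidean_space \<times> 'e) set \<Rightarrow> ('e \<times> 'e \<Rightarrow> real) \<Rightarrow> bool" where
  "regular_Lagrangian W L \<longleftrightarrow> open W \<and> smooth_on W L \<and>
     (\<forall>z\<in>W. \<forall>u. (\<forall>a. dd (0, u) (dd (0, a) L) z = 0) \<longrightarrow> u = 0)"

text \<open>For a curve with position and velocity z and acceleration u, this is the equation
  d/dt (D_y L) = D_x L, tested against every direction a.\<close>

definition Euler_Lagrange :: "('e::euclidean_space \<times> 'e \<Rightarrow> real) \<Rightarrow> 'e \<times> 'e \<Rightarrow> 'e \<Rightarrow> bool" where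
  "Euler_Lagrange L z u \<longleftrightarrow> (\<forall>a. dd (snd z, u) (dd (0, a) L) z = dd (a, 0) L z)"

definition spray :: "('e::euclidean_space \<times> 'e \<Rightarrow> real) \<Rightarrow> 'e \<times> 'e \<Rightarrow> 'e" where
  "spray L z = (THE u. Euler_Lagrange L z u)"

lemma dd_Pair_split:
  assumes "g differentiable (at z)"
  shows "dd (y, u) g z = dd (y, 0) g z + dd (0, u) g z"
  using linear_add[OF linear_dd[OF assms], of "(y, 0)" "(0, u)"] by simp

lemma Euler_Lagrange_unique:
  assumes L: "regular_Lagrangian W L" and z: "z \<in> W"
    and u: "Euler_Lagrange L z u" and u': "Euler_Lagrange L z u'"
  shows "u = u'"
proof -
  have d: "dd (0, a) L differentiable (at z)" for a
    using L z smooth_on_dd smooth_on_differentiable by (metis regular_Lagrangian_def)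
  have "dd (0, u - u') (dd (0, a) L) z = 0" for a
    using linear_diff[OF linear_dd[OF d[of a]], of "(snd z, u)" "(snd z, u')"] u u'
    by (simp add: Euler_Lagrange_def)
  then have "u - u' = 0" using L z unfolding regular_Lagrangian_def by blast
  then show ?thesis by simp
qed

text \<open>Written with respect to an orthonormal basis, the Euler-Lagrange equation is the linear system
  \<open>fibre_Hessian L z u = EL_force L z\<close> for the acceleration u.\<close>

definition fibre_Hessian :: "('e::euclidean_space \<times> 'e \<Rightarrow> real) \<Rightarrow> 'e \<times> 'e \<Rightarrow> 'e \<Rightarrow> 'e" where
  "fibre_Hessian L z u = (\<Sum>b\<in>Basis. dd (0, u) (dd (0, b) L) z *\<^sub>R b)"

definition EL_force :: "('e::euclidean_space \<times> 'e \<Rightarrow> real) \<Rightarrow> 'e \<times> 'e \<Rightarrow> 'e" where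
  "EL_force L z = (\<Sum>b\<in>Basis. (dd (b, 0) L z - dd (snd z, 0) (dd (0, b) L) z) *\<^sub>R b)"

lemma inner_fibre_Hessian:
  "b \<in> Basis \<Longrightarrow> fibre_Hessian L z u \<bullet> b = dd (0, u) (dd (0, b) L) z"
  unfolding fibre_Hessian_def by (rule inner_sum_left_Basis)

lemma linear_fibre_Hessian:
  assumes "smooth_on W L" "z \<in> W"
  shows "linear (fibre_Hessian L z)"
proof -
  have l: "linear (\<lambda>v. dd v (dd (0, b) L) z)" for b
    by (intro linear_dd smooth_on_differentiable smooth_on_dd) (use assms in auto)
  have "dd (0, u + u') (dd (0, b) L) z = dd (0, u) (dd (0, b) L) z + dd (0, u') (dd (0, b) L) z" for u u' b
    using linear_add[OF l[of b], of "(0, u)" "(0, u')"] by simp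
  moreover have "dd (0, c *\<^sub>R u) (dd (0, b) L) z = c *\<^sub>R dd (0, u) (dd (0, b) L) z" for u c b
    using linear_cmul[OF l[of b], of c "(0, u)"] by simp
  ultimately show ?thesis
    unfolding fibre_Hessian_def
    by (intro linearI) (simp_all add: scaleR_add_left sum.distrib scaleR_sum_right)
qed

lemma linear_dd_dd_fibre:
  fixes L :: "'a::euclidean_space \<times> 'a \<Rightarrow> real"
  assumes "open W" "smooth_on W L" "z \<in> W"
  shows "linear (\<lambda>a. dd v (dd (0, a) L) z)" "linear (\<lambda>a. dd (a, 0) L z)" "linear (\<lambda>a. dd (0, a) L z)"
proof -
  have B: "bilinear (\<lambda>v w. dd v (dd w L) z)"
    by (rule bilinear_dd_dd[OF assms(1,3) smooth_on_Ck[OF assms(2)]])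
  have l: "linear (\<lambda>w. dd w L z)"
    by (rule linear_dd[OF smooth_on_differentiable[OF assms(2,3)]])
  have i: "linear (\<lambda>a::'a. (0::'a, a))" "linear (\<lambda>a::'a. (a, 0::'a))"
    by (auto intro!: linearI)
  show "linear (\<lambda>a. dd v (dd (0, a) L) z)"
  proof -
    have "linear (\<lambda>w. dd v (dd w L) z)" using B unfolding bilinear_def by blast
    from linear_compose[OF i(1) this] show ?thesis by (simp add: o_def)
  qed
  show "linear (\<lambda>a. dd (a, 0) L z)" "linear (\<lambda>a. dd (0, a) L z)"
    using linear_compose[OF i(2) l] linear_compose[OF i(1) l] by (simp_all add: o_def)
qed

lemma Euler_Lagrange_iff:
  assumes W: "open W" "smooth_on W L" "z \<in> W"
  shows "Euler_Lagrange L z u \<longleftrightarrow> fibre_Hessian L z u = EL_force L z"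
proof -
  have split: "dd (snd z, u) (dd (0, a) L) z = dd (snd z, 0) (dd (0, a) L) z + dd (0, u) (dd (0, a) L) z" for a
    by (intro dd_Pair_split smooth_on_differentiable[OF smooth_on_dd[OF W(2)] W(3)])
  have "fibre_Hessian L z u = EL_force L z \<longleftrightarrow>
    (\<forall>b\<in>Basis. dd (0, u) (dd (0, b) L) z = dd (b, 0) L z - dd (snd z, 0) (dd (0, b) L) z)"
    by (subst euclidean_eq_iff) (simp add: inner_fibre_Hessian EL_force_def)
  also have "\<dots> \<longleftrightarrow> (\<forall>b\<in>Basis. dd (snd z, u) (dd (0, b) L) z = dd (b, 0) L z)"
    by (auto simp: split)
  also have "\<dots> \<longleftrightarrow> Euler_Lagrange L z u"
  proof
    assume *: "\<forall>b\<in>Basis. dd (snd z, u) (dd (0, b) L) z = dd (b, 0) L z"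
    have "dd (snd z, u) (dd (0, a) L) z = dd (a, 0) L z" for a
      using * by (subst linear_expand_Basis[OF linear_dd_dd_fibre(1)[OF W]],
        subst linear_expand_Basis[OF linear_dd_dd_fibre(2)[OF W]]) simp
    then show "Euler_Lagrange L z u" by (simp add: Euler_Lagrange_def)
  qed (simp add: Euler_Lagrange_def)
  finally show ?thesis by simp
qed

lemma inj_fibre_Hessian:
  assumes L: "regular_Lagrangian W L" and z: "z \<in> W"
  shows "inj (fibre_Hessian L z)"
proof -
  have W: "open W" "smooth_on W L" using L by (auto simp: regular_Lagrangian_def)
  have "u = 0" if "fibre_Hessian L z u = 0" for u
  proof -
    have 0: "dd (0, u) (dd (0, b) L) z = 0" if "b \<in> Basis" for b
      using inner_fibre_Hessian[OF that, of L z u] \<open>fibre_Hessian L z u = 0\<close> by simp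
    have "dd (0, u) (dd (0, a) L) z = 0" for a
      by (subst linear_expand_Basis[OF linear_dd_dd_fibre(1)[OF W z]]) (simp add: 0)
    then show ?thesis using L z unfolding regular_Lagrangian_def by blast
  qed
  then show ?thesis using linear_injective_0[OF linear_fibre_Hessian[OF W(2) z]] by blast
qed

lemma fibre_Hessian_spray:
  assumes L: "regular_Lagrangian W L" and z: "z \<in> W"
  shows "fibre_Hessian L z (spray L z) = EL_force L z"
proof -
  have W: "open W" "smooth_on W L" using L by (auto simp: regular_Lagrangian_def)
  have "surj (fibre_Hessian L z)"
    by (simp add: linear_injective_imp_surjective linear_fibre_Hessian[OF W(2) z] inj_fibre_Hessian[OF L z])
  then obtain u where "EL_force L z = fibre_Hessian L z u" by (meson surjD)
  then have u: "Euler_Lagrange L z u" using Euler_Lagrange_iff[OF W z] by simp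
  then have "Euler_Lagrange L z (spray L z)"
    unfolding spray_def by (rule theI) (rule Euler_Lagrange_unique[OF L z _ u])
  then show ?thesis using Euler_Lagrange_iff[OF W z] by simp
qed

lemma Euler_Lagrange_spray:
  assumes "regular_Lagrangian W L" "z \<in> W"
  shows "Euler_Lagrange L z (spray L z)"
  using fibre_Hessian_spray[OF assms] Euler_Lagrange_iff assms by (metis regular_Lagrangian_def)

lemma smooth_on_spray:
  assumes L: "regular_Lagrangian W L"
  shows "smooth_on W (spray L)"
  unfolding smooth_on_def
proof
  fix k
  have W: "open W" "smooth_on W L" using L by (auto simp: regular_Lagrangian_def)
  have bl: "bounded_linear (\<lambda>c::real. c *\<^sub>R b)" for b :: 'a by (rule bounded_linear_scaleR_left)
  have bs: "bounded_linear (\<lambda>z::'a \<times> 'a. (snd z, 0::'a))"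
    by (intro bounded_linear_Pair bounded_linear_snd bounded_linear_zero)
  show "Ck_on k W (spray L)"
  proof (rule Ck_on_linear_solution[OF W(1) linear_fibre_Hessian[OF W(2)] inj_fibre_Hessian[OF L]
        _ _ fibre_Hessian_spray[OF L]])
    show "Ck_on k W (\<lambda>z. fibre_Hessian L z u)" for u
      unfolding fibre_Hessian_def
      by (intro Ck_on_sum Ck_on_bounded_linear[OF bl] W(1) smooth_on_Ck smooth_on_dd W(2))
    show "Ck_on k W (EL_force L)"
      unfolding EL_force_def
      by (intro Ck_on_sum Ck_on_bounded_linear[OF bl] Ck_on_diff W(1) smooth_on_Ck smooth_on_dd W(2)
          Ck_on_frechet_derivative_fun Ck_on_linear_fun[OF bs])
  qed
qed

section \<open>Local isometries\<close>

text \<open>The coordinate expression of an isometry between two charts. The nonemptiness assumption provides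
  the velocities over which D^2 f is polarized.\<close>

locale local_isometry =
  fixes W W' :: "('e::euclidean_space \<times> 'e) set" and L L' :: "'e \<times> 'e \<Rightarrow> real"
    and \<Omega> :: "'e set" and f :: "'e \<Rightarrow> 'e"
  assumes L: "regular_Lagrangian W L" and L': "regular_Lagrangian W' L'"
    and open_\<Omega>: "open \<Omega>" and C2: "Ck_on 2 \<Omega> f"
    and maps: "\<And>x y. x \<in> \<Omega> \<Longrightarrow> (x, y) \<in> W \<Longrightarrow> (f x, dd y f x) \<in> W'"
    and preserves: "\<And>x y. x \<in> \<Omega> \<Longrightarrow> (x, y) \<in> W \<Longrightarrow> L' (f x, dd y f x) = L (x, y)"
    and surj: "\<And>x. x \<in> \<Omega> \<Longrightarrow> surj (\<lambda>v. dd v f x)"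
    and nonempty: "\<And>x. x \<in> \<Omega> \<Longrightarrow> \<exists>y. (x, y) \<in> W"
begin

lemma source_open_smooth: "open W" "smooth_on W L" and target_open_smooth: "open W'" "smooth_on W' L'"
  using L L' by (auto simp: regular_Lagrangian_def)

lemma diff_f: "x \<in> \<Omega> \<Longrightarrow> f differentiable (at x)" and diff_df: "x \<in> \<Omega> \<Longrightarrow> dd v f differentiable (at x)"
  using C2 by (auto simp: numeral_2_eq_2)

lemma tangent_lift_has_derivative:
  assumes x: "x \<in> \<Omega>"
  shows "((\<lambda>z. (f (fst z), dd (snd z) f (fst z))) has_derivative
    (\<lambda>v. (dd (fst v) f x, dd (fst v) (dd y f) x + dd (snd v) f x))) (at (x, y))"
proof -
  let ?V = "fst -` \<Omega> :: ('e \<times> 'e) set"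
  have V: "open ?V" "(x, y) \<in> ?V" using open_\<Omega> x by (auto intro: open_vimage_fst)
  have f1: "((\<lambda>z::'e \<times> 'e. g (fst z)) has_derivative (\<lambda>v. dd (fst v) g x)) (at (x, y))"
    if "g differentiable (at x)" for g :: "'e \<Rightarrow> 'e"
    using has_derivative_compose[OF has_derivative_fst[OF has_derivative_ident], of g _ "(x, y)" UNIV]
      has_derivative_dd[OF that] by simp
  have "((\<lambda>z. \<Sum>b\<in>Basis. (snd z \<bullet> b) *\<^sub>R dd b f (fst z)) has_derivative
     (\<lambda>v. \<Sum>b\<in>Basis. (y \<bullet> b) *\<^sub>R dd (fst v) (dd b f) x + (snd v \<bullet> b) *\<^sub>R dd b f x)) (at (x, y))"
  proof (intro has_derivative_sum)
    fix b :: 'e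
    have "((\<lambda>z::'e \<times> 'e. snd z \<bullet> b) has_derivative (\<lambda>v. snd v \<bullet> b)) (at (x, y))"
      by (intro has_derivative_inner_left has_derivative_snd has_derivative_ident)
    from has_derivative_scaleR[OF this f1[OF diff_df[OF x]]]
    show "((\<lambda>z. (snd z \<bullet> b) *\<^sub>R dd b f (fst z)) has_derivative
       (\<lambda>v. (y \<bullet> b) *\<^sub>R dd (fst v) (dd b f) x + (snd v \<bullet> b) *\<^sub>R dd b f x)) (at (x, y))" by simp
  qed
  moreover have "(\<Sum>b\<in>Basis. (y \<bullet> b) *\<^sub>R dd v (dd b f) x + (u \<bullet> b) *\<^sub>R dd b f x) = dd v (dd y f) x + dd u f x" for v u
  proof -
    have "linear (\<lambda>w. dd v (dd w f) x)"
      using bilinear_dd_dd[OF open_\<Omega> x C2] by (simp add: bilinear_def)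
    from linear_expand_Basis[OF this, of y] linear_expand_Basis[OF linear_dd[OF diff_f[OF x]], of u]
    show ?thesis by (simp add: sum.distrib)
  qed
  ultimately have "((\<lambda>z. \<Sum>b\<in>Basis. (snd z \<bullet> b) *\<^sub>R dd b f (fst z)) has_derivative
     (\<lambda>v. dd (fst v) (dd y f) x + dd (snd v) f x)) (at (x, y))" by simp
  moreover have "dd (snd z) f (fst z) = (\<Sum>b\<in>Basis. (snd z \<bullet> b) *\<^sub>R dd b f (fst z))" if "z \<in> ?V" for z
    using linear_expand_Basis[OF linear_dd[OF diff_f]] that by auto
  ultimately have "((\<lambda>z. dd (snd z) f (fst z)) has_derivative
     (\<lambda>v. dd (fst v) (dd y f) x + dd (snd v) f x)) (at (x, y))"
    using has_derivative_cong_open[OF V, of "\<lambda>z. dd (snd z) f (fst z)" "\<lambda>z. \<Sum>b\<in>Basis. (snd z \<bullet> b) *\<^sub>R dd b f (fst z)"]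
    by simp
  from has_derivative_Pair[OF f1[OF diff_f[OF x]] this] show ?thesis .
qed

text \<open>The x-derivative of L'(f(x), Df(x) y) = L(x, y) in the direction a contains the term with D^2 f(x)(a, y),
  and the derivative of its y-derivative along (y, S(x, y)) contains the same term with
  D^2 f(x)(y, a). By symmetry they cancel when the Euler-Lagrange equation of L is inserted, and what remains is the
  Euler-Lagrange equation of L' for the acceleration D^2 f(x)(y, y) + Df(x) S(x, y), tested against all
  Df(x) a. As Df(x) is onto, uniqueness of the spray applies.\<close>

lemma spray_transforms:
  assumes x: "x \<in> \<Omega>" and xy: "(x, y) \<in> W"
  shows "dd y (dd y f) x + dd (spray L (x, y)) f x = spray L' (f x, dd y f x)"
proof -
  note W = source_open_smooth and W' = target_open_smooth
  let ?\<phi> = "\<lambda>z. (f (fst z), dd (snd z) f (fst z))"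
  define V where "V = W \<inter> fst -` \<Omega>"
  have V: "open V" using W(1) open_\<Omega> by (auto simp: V_def intro: open_vimage_fst)
  have dL': "g differentiable (at (?\<phi> z))" if "z \<in> V" "smooth_on W' g" for g :: "'e \<times> 'e \<Rightarrow> real" and z
    using maps[of "fst z" "snd z"] that smooth_on_differentiable by (auto simp: V_def)
  have chain: "dd (a, u) L z = dd (dd a f (fst z), dd a (dd (snd z) f) (fst z) + dd u f (fst z)) L' (?\<phi> z)"
    if z: "z \<in> V" for z a u
  proof -
    obtain x y where xy: "z = (x, y)" "x \<in> \<Omega>" using z by (cases z) (auto simp: V_def)
    have "((\<lambda>z. L' (?\<phi> z)) has_derivative
       (\<lambda>v. dd (dd (fst v) f x, dd (fst v) (dd y f) x + dd (snd v) f x) L' (?\<phi> z))) (at z)"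
      using has_derivative_compose[OF tangent_lift_has_derivative[OF xy(2)] has_derivative_dd[OF dL'[OF z W'(2)], unfolded xy(1)]]
      unfolding xy(1) by simp
    moreover have "L' (?\<phi> z) = L z" if "z \<in> V" for z
      using preserves[of "fst z" "snd z"] that by (auto simp: V_def)
    ultimately have "(L has_derivative
       (\<lambda>v. dd (dd (fst v) f x, dd (fst v) (dd y f) x + dd (snd v) f x) L' (?\<phi> z))) (at z)"
      using has_derivative_cong_open[OF V z, of "\<lambda>z. L' (?\<phi> z)" L] by simp
    from dd_eqI[OF this, where v="(a, u)"] show ?thesis by (simp add: xy(1))
  qed
  define z where "z = (x, y)"
  define s where "s = spray L z"
  define D where "D = dd y (dd y f) x + dd s f x"
  have z: "z \<in> V" using x xy by (simp add: V_def z_def)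
  have \<phi>z: "?\<phi> z = (f x, dd y f x)" "?\<phi> z \<in> W'" using maps[OF x xy] by (auto simp: z_def)
  have lin': "linear (\<lambda>a. dd (0, a) L' (?\<phi> z))" if "z \<in> V" for z
    using linear_dd_dd_fibre(3)[OF W'] maps[of "fst z" "snd z"] that by (auto simp: V_def)
  have EL: "dd (y, s) (dd (0, a) L) z = dd (a, 0) L z" for a
    using Euler_Lagrange_spray[OF L xy] by (simp add: Euler_Lagrange_def z_def s_def)
  have key: "dd (dd y f x, D) (dd (0, dd a f x) L') (?\<phi> z) = dd (dd a f x, 0) L' (?\<phi> z)" for a
  proof -
    have fib: "dd (0, a) L z = (\<Sum>b\<in>Basis. (dd a f (fst z) \<bullet> b) *\<^sub>R dd (0, b) L' (?\<phi> z))" if "z \<in> V" for z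
    proof -
      have x: "fst z \<in> \<Omega>" using that by (simp add: V_def)
      have "dd 0 f (fst z) = 0" "dd 0 (dd (snd z) f) (fst z) = 0"
        by (intro linear_0 linear_dd diff_f diff_df x)+
      with chain[OF that, of 0 a] have "dd (0, a) L z = dd (0, dd a f (fst z)) L' (?\<phi> z)" by simp
      also have "\<dots> = (\<Sum>b\<in>Basis. (dd a f (fst z) \<bullet> b) *\<^sub>R dd (0, b) L' (?\<phi> z))"
        by (rule linear_expand_Basis[OF lin'[OF that]])
      finally show ?thesis .
    qed
    have "((\<lambda>z. \<Sum>b\<in>Basis. (dd a f (fst z) \<bullet> b) *\<^sub>R dd (0, b) L' (?\<phi> z)) has_derivative
       (\<lambda>v. \<Sum>b\<in>Basis. (dd a f x \<bullet> b) *\<^sub>R dd (dd (fst v) f x, dd (fst v) (dd y f) x + dd (snd v) f x) (dd (0, b) L') (?\<phi> z)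
          + (dd (fst v) (dd a f) x \<bullet> b) *\<^sub>R dd (0, b) L' (?\<phi> z))) (at z)"
    proof (intro has_derivative_sum)
      fix b :: 'e
      have "((\<lambda>z::'e \<times> 'e. dd a f (fst z)) has_derivative (\<lambda>v. dd (fst v) (dd a f) x)) (at z)"
        using has_derivative_compose[OF has_derivative_fst[OF has_derivative_ident], of "dd a f" _ z UNIV]
          has_derivative_dd[OF diff_df[OF x]] by (simp add: z_def)
      then have 1: "((\<lambda>z::'e \<times> 'e. dd a f (fst z) \<bullet> b) has_derivative (\<lambda>v. dd (fst v) (dd a f) x \<bullet> b)) (at z)"
        by (rule has_derivative_inner_left)
      have 2: "((\<lambda>z. dd (0, b) L' (?\<phi> z)) has_derivative
          (\<lambda>v. dd (dd (fst v) f x, dd (fst v) (dd y f) x + dd (snd v) f x) (dd (0, b) L') (?\<phi> z))) (at z)"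
        using has_derivative_compose[OF tangent_lift_has_derivative[OF x]
            has_derivative_dd[OF dL'[OF z smooth_on_dd[OF W'(2)]], unfolded z_def]]
        unfolding z_def by simp
      show "((\<lambda>z. (dd a f (fst z) \<bullet> b) *\<^sub>R dd (0, b) L' (?\<phi> z)) has_derivative
       (\<lambda>v. (dd a f x \<bullet> b) *\<^sub>R dd (dd (fst v) f x, dd (fst v) (dd y f) x + dd (snd v) f x) (dd (0, b) L') (?\<phi> z)
          + (dd (fst v) (dd a f) x \<bullet> b) *\<^sub>R dd (0, b) L' (?\<phi> z))) (at z)"
        using has_derivative_scaleR[OF 1 2] by (simp add: z_def)
    qed
    from dd_cong_open[OF V z fib, where v="(y, s)"] dd_eqI[OF this, where v="(y, s)"]
    have "dd (y, s) (dd (0, a) L) z = (\<Sum>b\<in>Basis. (dd a f x \<bullet> b) *\<^sub>R dd (dd y f x, D) (dd (0, b) L') (?\<phi> z)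
          + (dd y (dd a f) x \<bullet> b) *\<^sub>R dd (0, b) L' (?\<phi> z))"
      by (simp add: D_def)
    also have "\<dots> = dd (dd y f x, D) (dd (0, dd a f x) L') (?\<phi> z) + dd (0, dd y (dd a f) x) L' (?\<phi> z)"
      unfolding linear_expand_Basis[OF lin'[OF z], of "dd y (dd a f) x"]
        linear_expand_Basis[OF linear_dd_dd_fibre(1)[OF W' \<phi>z(2), of "(dd y f x, D)"], of "dd a f x"]
      by (simp add: sum.distrib)
    finally have 1: "dd (a, 0) L z = dd (dd y f x, D) (dd (0, dd a f x) L') (?\<phi> z) + dd (0, dd y (dd a f) x) L' (?\<phi> z)"
      by (simp add: EL)
    have "dd 0 f x = 0" by (intro linear_0 linear_dd diff_f x)
    with chain[OF z, of a 0] have "dd (a, 0) L z = dd (dd a f x, dd a (dd y f) x) L' (?\<phi> z)"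
      by (simp add: z_def)
    also have "\<dots> = dd (dd a f x, 0) L' (?\<phi> z) + dd (0, dd a (dd y f) x) L' (?\<phi> z)"
      by (rule dd_Pair_split[OF dL'[OF z W'(2)]])
    finally show ?thesis using 1 dd_commute[OF open_\<Omega> x C2, of a y] by simp
  qed
  have "Euler_Lagrange L' (?\<phi> z) D"
    unfolding Euler_Lagrange_def
  proof
    fix a'
    obtain a where "a' = dd a f x" using surj[OF x] by (meson surjD)
    then show "dd (snd (?\<phi> z), D) (dd (0, a') L') (?\<phi> z) = dd (a', 0) L' (?\<phi> z)"
      using key[of a] by (simp add: z_def)
  qed
  then have "D = spray L' (?\<phi> z)"
    using Euler_Lagrange_unique[OF L' \<phi>z(2) _ Euler_Lagrange_spray[OF L' \<phi>z(2)]] by blast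
  then show ?thesis by (simp add: D_def s_def z_def)
qed

lemma open_slice: "open {x \<in> \<Omega>. (x, y) \<in> W}" "open {y. (x, y) \<in> W}"
proof -
  have "open ((\<lambda>x. (x, y)) -` W)" "open (Pair x -` W)"
    by (intro open_vimage source_open_smooth(1) continuous_intros)+
  moreover have "{x \<in> \<Omega>. (x, y) \<in> W} = \<Omega> \<inter> (\<lambda>x. (x, y)) -` W" by auto
  ultimately show "open {x \<in> \<Omega>. (x, y) \<in> W}" "open {y. (x, y) \<in> W}"
    using open_\<Omega> by (auto simp: vimage_def)
qed

lemma second_derivative_polarized:
  assumes x0: "x0 \<in> \<Omega>"
  obtains c y1 y2 y3 y4 where "c > 0" "(x0, y1) \<in> W" "(x0, y2) \<in> W" "(x0, y3) \<in> W" "(x0, y4) \<in> W"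
    and "\<And>B. bilinear B \<Longrightarrow> (\<And>v w. B v w = B w v) \<Longrightarrow>
      (B v w :: 'e) = c *\<^sub>R (B y1 y1 - B y2 y2 - B y3 y3 + B y4 y4)"
proof -
  obtain y where y: "(x0, y) \<in> W" using nonempty[OF x0] by blast
  obtain c where c: "c > 0" "(x0, y + c *\<^sub>R v + c *\<^sub>R w) \<in> W" "(x0, y + c *\<^sub>R v) \<in> W" "(x0, y + c *\<^sub>R w) \<in> W"
    using polarization_points[OF open_slice(2), of y x0 v w] y by blast
  have "B v w = (1 / (2 * c * c)) *\<^sub>R (B (y + c *\<^sub>R v + c *\<^sub>R w) (y + c *\<^sub>R v + c *\<^sub>R w)
      - B (y + c *\<^sub>R v) (y + c *\<^sub>R v) - B (y + c *\<^sub>R w) (y + c *\<^sub>R w) + B y y)"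
    if "bilinear B" "\<And>v w. B v w = B w v" for B :: "'e \<Rightarrow> 'e \<Rightarrow> 'e"
    using polarization[OF that, of "c *\<^sub>R v" "c *\<^sub>R w" y, symmetric] c(1)
    by (simp add: bilinear_lmul[OF that(1)] bilinear_rmul[OF that(1)])
  then show ?thesis using that[of "1 / (2 * c * c)"] c y by simp
qed

lemma bilinear_second_derivative:
  assumes "x \<in> \<Omega>"
  shows "bilinear (\<lambda>v w. dd v (dd w f) x)" "dd v (dd w f) x = dd w (dd v f) x"
  by (rule bilinear_dd_dd[OF open_\<Omega> assms C2], rule dd_commute[OF open_\<Omega> assms C2])

lemma Ck_on_diagonal_second_derivative:
  assumes k: "Ck_on (Suc k) \<Omega> f"
  shows "Ck_on k {x \<in> \<Omega>. (x, y) \<in> W} (\<lambda>x. dd y (dd y f) x)"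
proof -
  let ?U = "{x \<in> \<Omega>. (x, y) \<in> W}"
  note U = open_slice(1)[of y]
  have f: "Ck_on (Suc k) ?U f" by (rule Ck_on_subset[OF k]) auto
  have "Ck_on k ?U (\<lambda>x. spray L' (f x, dd y f x))"
    by (rule Ck_on_compose[OF U _ Ck_on_Pair[OF U Ck_on_SucD[OF f] Ck_on_dd[OF f]]
          smooth_on_Ck[OF smooth_on_spray[OF L']]]) (use maps in auto)
  moreover have "bounded_linear (\<lambda>x::'e. (x, 0::'e))"
    by (intro bounded_linear_Pair bounded_linear_ident bounded_linear_zero)
  from Ck_on_add[OF U Ck_on_linear_fun[OF this U] Ck_on_const, of k "(0, y)"]
  have "Ck_on k ?U (\<lambda>x. (x, y))" by simp
  then have "Ck_on k ?U (\<lambda>x. spray L (x, y))"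
    by (rule Ck_on_compose[OF U _ _ smooth_on_Ck[OF smooth_on_spray[OF L]], rotated]) auto
  ultimately have "Ck_on k ?U (\<lambda>x. spray L' (f x, dd y f x) - dd (spray L (x, y)) f x)"
    by (intro Ck_on_diff U Ck_on_frechet_derivative_fun[OF U f])
  moreover have "spray L' (f x, dd y f x) - dd (spray L (x, y)) f x = dd y (dd y f) x" if "x \<in> ?U" for x
    using spray_transforms[of x y] that by (simp add: algebra_simps)
  ultimately show ?thesis by (rule Ck_on_transform) (assumption, rule U)
qed

lemma Ck_on_bootstrap:
  assumes k: "Ck_on (Suc k) \<Omega> f"
  shows "Ck_on (Suc (Suc k)) \<Omega> f"
proof -
  have "Ck_on k \<Omega> (dd v (dd w f))" for v w
  proof (rule Ck_on_local)
    fix x0 assume x0: "x0 \<in> \<Omega>"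
    obtain c y1 y2 y3 y4 where y: "(x0, y1) \<in> W" "(x0, y2) \<in> W" "(x0, y3) \<in> W" "(x0, y4) \<in> W"
      and pol: "\<And>B. bilinear B \<Longrightarrow> (\<And>v w. B v w = B w v) \<Longrightarrow>
        (B v w :: 'e) = c *\<^sub>R (B y1 y1 - B y2 y2 - B y3 y3 + B y4 y4)"
      by (rule second_derivative_polarized[OF x0, of v w]) blast
    define U where "U = {x \<in> \<Omega>. (x, y1) \<in> W} \<inter> {x \<in> \<Omega>. (x, y2) \<in> W} \<inter> {x \<in> \<Omega>. (x, y3) \<in> W} \<inter> {x \<in> \<Omega>. (x, y4) \<in> W}"
    have U: "open U" "x0 \<in> U" using y x0 by (auto simp: U_def intro!: open_Int open_slice)
    have Q: "Ck_on k U (\<lambda>x. dd y (dd y f) x)" if "y \<in> {y1, y2, y3, y4}" for y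
      by (rule Ck_on_subset[OF Ck_on_diagonal_second_derivative[OF k]]) (use that in \<open>auto simp: U_def\<close>)
    have "Ck_on k U (\<lambda>x. c *\<^sub>R (dd y1 (dd y1 f) x - dd y2 (dd y2 f) x - dd y3 (dd y3 f) x + dd y4 (dd y4 f) x))"
      by (intro Ck_on_bounded_linear[OF bounded_linear_scaleR_right] Ck_on_add Ck_on_diff U(1) Q) auto
    moreover have "c *\<^sub>R (dd y1 (dd y1 f) x - dd y2 (dd y2 f) x - dd y3 (dd y3 f) x + dd y4 (dd y4 f) x) = dd v (dd w f) x"
      if "x \<in> U" for x
    proof -
      have "x \<in> \<Omega>" using that by (simp add: U_def)
      from pol[OF bilinear_second_derivative[OF this]] show ?thesis by simp
    qed
    ultimately have "Ck_on k U (dd v (dd w f))" by (rule Ck_on_transform) (assumption, rule U)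
    then show "\<exists>U. open U \<and> x0 \<in> U \<and> Ck_on k U (dd v (dd w f))" using U by blast
  qed
  then show ?thesis using diff_f diff_df by simp
qed

lemma smooth_on_isometry: "smooth_on \<Omega> f"
proof -
  have "Ck_on (Suc (Suc k)) \<Omega> f" for k
    by (induction k) (use C2 Ck_on_bootstrap in \<open>simp_all add: numeral_2_eq_2 del: Ck_on.simps\<close>)
  then show ?thesis unfolding smooth_on_def using Ck_on_SucD by blast
qed

end

text \<open>The functions to which \<open>vanish_of_linear_differential_inequality\<close> is applied are f - g and the partial
  derivatives of f - g. Local Lipschitz continuity of the spray bounds the diagonal values of
  D^2(f - g), and polarization bounds the rest.\<close>

lemma local_isometry_unique:
  fixes f g :: "'e::euclidean_space \<Rightarrow> 'e"
  assumes f: "local_isometry W W' L L' \<Omega> f" and g: "local_isometry W W' L L' \<Omega> g"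
    and x0: "x0 \<in> \<Omega>" and fg: "f x0 = g x0" and dfg: "\<And>v. dd v f x0 = dd v g x0"
  shows "\<forall>\<^sub>F x in nhds x0. f x = g x"
proof -
  interpret f: local_isometry W W' L L' \<Omega> f by (rule f)
  interpret g: local_isometry W W' L L' \<Omega> g by (rule g)
  define N where "N x = norm (f x - g x) + (\<Sum>b\<in>Basis. norm (dd b f x - dd b g x))" for x
  have sum0: "(\<Sum>b\<in>Basis. norm (dd b f x - dd b g x)) \<ge> 0" for x by (simp add: sum_nonneg)
  have N0: "N x \<ge> 0" for x using sum0[of x] by (simp add: N_def)
  have Nf: "norm (f x - g x) \<le> N x" for x using sum0[of x] by (simp add: N_def)
  have Nd: "norm (dd s f x - dd s g x) \<le> N x * norm s" if "x \<in> \<Omega>" for x s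
  proof -
    have "linear (\<lambda>s. dd s f x - dd s g x)"
      by (intro linear_compose_sub linear_dd f.diff_f g.diff_f that)
    from norm_linear_le_Basis[OF this, of s]
    have "norm (dd s f x - dd s g x) \<le> (\<Sum>b\<in>Basis. norm (dd b f x - dd b g x)) * norm s" .
    also have "\<dots> \<le> N x * norm s" by (intro mult_right_mono) (simp_all add: N_def)
    finally show ?thesis .
  qed
  have in\<Omega>: "\<forall>\<^sub>F x in nhds x0. x \<in> \<Omega>" using eventually_nhds_in_open[OF f.open_\<Omega> x0] .
  have diag: "\<exists>K. \<forall>\<^sub>F x in nhds x0. norm (dd y (dd y f) x - dd y (dd y g) x) \<le> K * N x"
    if y: "(x0, y) \<in> W" for y
  proof -
    let ?z0 = "(f x0, dd y f x0)"
    have "?z0 \<in> W'" using f.maps[OF x0 y] .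
    from C1_locally_Lipschitz[OF f.target_open_smooth(1) this smooth_on_Ck[OF smooth_on_spray[OF f.L']]]
    obtain K r where K: "K \<ge> 0" "r > 0"
      "\<And>z z'. z \<in> ball ?z0 r \<Longrightarrow> z' \<in> ball ?z0 r \<Longrightarrow> norm (spray L' z - spray L' z') \<le> K * norm (z - z')" by blast
    have lift: "\<forall>\<^sub>F x in nhds x0. (h x, dd y h x) \<in> ball ?z0 r"
      if h: "Ck_on 2 \<Omega> h" "(h x0, dd y h x0) = ?z0" for h
    proof -
      have "h differentiable (at x0)" "dd y h differentiable (at x0)"
        using h(1) x0 by (simp_all add: numeral_2_eq_2)
      then have "((\<lambda>x. (h x, dd y h x)) \<longlongrightarrow> (h x0, dd y h x0)) (nhds x0)"
        by (intro tendsto_Pair isCont_tendsto_nhds differentiable_imp_continuous_within)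
      then have "((\<lambda>x. (h x, dd y h x)) \<longlongrightarrow> ?z0) (nhds x0)" by (simp only: h(2))
      from topological_tendstoD[OF this open_ball[of ?z0 r]] show ?thesis using K(2) by simp
    qed
    have "isCont (\<lambda>x. spray L (x, y)) x0"
    proof -
      have "isCont (\<lambda>x. (x, y)) x0" by (intro continuous_intros)
      moreover have "isCont (spray L) (x0, y)"
        using smooth_on_differentiable[OF smooth_on_spray[OF f.L] y] by (rule differentiable_imp_continuous_within)
      ultimately show ?thesis by (rule isCont_o2)
    qed
    then have "isCont (\<lambda>x. norm (spray L (x, y))) x0" by (rule continuous_norm)
    from order_tendstoD(2)[OF isCont_tendsto_nhds[OF this]]
    have sp: "\<forall>\<^sub>F x in nhds x0. norm (spray L (x, y)) < norm (spray L (x0, y)) + 1" by simp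
    have slice: "\<forall>\<^sub>F x in nhds x0. x \<in> {x \<in> \<Omega>. (x, y) \<in> W}"
      by (rule eventually_nhds_in_open[OF f.open_slice(1)]) (use x0 y in simp)
    have "\<forall>\<^sub>F x in nhds x0. (g x, dd y g x) \<in> ball ?z0 r"
      by (rule lift[OF g.C2]) (simp add: fg dfg)
    with lift[OF f.C2 refl] sp slice
    have "\<forall>\<^sub>F x in nhds x0. norm (dd y (dd y f) x - dd y (dd y g) x)
      \<le> (K * (1 + norm y) + (norm (spray L (x0, y)) + 1)) * N x"
    proof eventually_elim
      case (elim x)
      let ?s = "spray L (x, y)"
      have x: "x \<in> \<Omega>" "(x, y) \<in> W" using elim by auto
      have "dd y (dd y f) x - dd y (dd y g) x =
        (spray L' (f x, dd y f x) - spray L' (g x, dd y g x)) - (dd ?s f x - dd ?s g x)"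
        unfolding f.spray_transforms[OF x, symmetric] g.spray_transforms[OF x, symmetric]
        by (simp add: algebra_simps)
      then have 1: "norm (dd y (dd y f) x - dd y (dd y g) x) \<le>
        norm (spray L' (f x, dd y f x) - spray L' (g x, dd y g x)) + norm (dd ?s f x - dd ?s g x)"
        by (simp add: norm_triangle_ineq4)
      have "norm ((f x, dd y f x) - (g x, dd y g x)) \<le> norm (f x - g x) + norm (dd y f x - dd y g x)"
        using norm_Pair_le[of "f x - g x" "dd y f x - dd y g x"] by simp
      also have "\<dots> \<le> (1 + norm y) * N x"
        using Nf[of x] Nd[OF x(1), of y] by (simp add: algebra_simps)
      finally have "K * norm ((f x, dd y f x) - (g x, dd y g x)) \<le> K * ((1 + norm y) * N x)"
        using K(1) by (intro mult_left_mono)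
      moreover have "norm (spray L' (f x, dd y f x) - spray L' (g x, dd y g x))
          \<le> K * norm ((f x, dd y f x) - (g x, dd y g x))"
        using elim by (intro K(3))
      ultimately have 2: "norm (spray L' (f x, dd y f x) - spray L' (g x, dd y g x)) \<le> K * ((1 + norm y) * N x)"
        by linarith
      have "norm (dd ?s f x - dd ?s g x) \<le> N x * norm ?s" by (rule Nd[OF x(1)])
      also have "\<dots> \<le> N x * (norm (spray L (x0, y)) + 1)"
        using elim N0 by (intro mult_left_mono) auto
      finally show ?case using 1 2 by (simp add: algebra_simps)
    qed
    then show ?thesis by blast
  qed
  have "\<exists>K. \<forall>\<^sub>F x in nhds x0. norm (dd v (dd w f) x - dd v (dd w g) x) \<le> K * N x" for v w
  proof -
    obtain c y1 y2 y3 y4 where c: "c > 0" and y: "(x0, y1) \<in> W" "(x0, y2) \<in> W" "(x0, y3) \<in> W" "(x0, y4) \<in> W"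
      and pol: "\<And>B. bilinear B \<Longrightarrow> (\<And>v w. B v w = B w v) \<Longrightarrow>
        (B v w :: 'e) = c *\<^sub>R (B y1 y1 - B y2 y2 - B y3 y3 + B y4 y4)"
      by (rule f.second_derivative_polarized[OF x0, of v w]) blast
    obtain K1 K2 K3 K4 where
      K: "\<forall>\<^sub>F x in nhds x0. norm (dd y1 (dd y1 f) x - dd y1 (dd y1 g) x) \<le> K1 * N x"
      "\<forall>\<^sub>F x in nhds x0. norm (dd y2 (dd y2 f) x - dd y2 (dd y2 g) x) \<le> K2 * N x"
      "\<forall>\<^sub>F x in nhds x0. norm (dd y3 (dd y3 f) x - dd y3 (dd y3 g) x) \<le> K3 * N x"
      "\<forall>\<^sub>F x in nhds x0. norm (dd y4 (dd y4 f) x - dd y4 (dd y4 g) x) \<le> K4 * N x"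
      using diag[OF y(1)] diag[OF y(2)] diag[OF y(3)] diag[OF y(4)] by blast
    have "\<forall>\<^sub>F x in nhds x0. norm (dd v (dd w f) x - dd v (dd w g) x) \<le> c * (K1 + K2 + K3 + K4) * N x"
      using K in\<Omega>
    proof eventually_elim
      case (elim x)
      let ?q = "\<lambda>y. dd y (dd y f) x - dd y (dd y g) x"
      have "dd v (dd w f) x - dd v (dd w g) x = c *\<^sub>R (?q y1 - ?q y2 - ?q y3 + ?q y4)"
        unfolding pol[OF f.bilinear_second_derivative[OF elim(5)]] pol[OF g.bilinear_second_derivative[OF elim(5)]]
        by (simp add: algebra_simps)
      moreover have "norm (?q y1 - ?q y2 - ?q y3 + ?q y4) \<le> norm (?q y1) + norm (?q y2) + norm (?q y3) + norm (?q y4)"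
        using norm_triangle_ineq[of "?q y1 - ?q y2 - ?q y3" "?q y4"] norm_triangle_ineq4[of "?q y1 - ?q y2" "?q y3"]
          norm_triangle_ineq4[of "?q y1" "?q y2"] by linarith
      moreover have "\<dots> \<le> (K1 + K2 + K3 + K4) * N x" using elim(1-4) by (simp add: algebra_simps)
      ultimately show ?case using c by (simp add: mult_left_mono)
    qed
    then show ?thesis by blast
  qed
  then have "\<forall>v. \<exists>Kv. \<forall>w. \<forall>\<^sub>F x in nhds x0. norm (dd v (dd w f) x - dd v (dd w g) x) \<le> Kv w * N x"
    by (intro allI choice)
  from choice[OF this]
  obtain K where K: "\<And>v w. \<forall>\<^sub>F x in nhds x0. norm (dd v (dd w f) x - dd v (dd w g) x) \<le> K v w * N x"
    by blast
  define C where "C = 1 + (\<Sum>w\<in>Basis. \<Sum>v\<in>Basis. \<bar>K v w\<bar>)"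
  define I where "I = insert None (Some ` (Basis :: 'e set))"
  \<comment> \<open>None indexes f - g itself, Some b its partial derivative in the basis direction b.\<close>
  define h where "h i x = (case i of None \<Rightarrow> f x - g x | Some b \<Rightarrow> dd b f x - dd b g x)" for i x
  have sumI: "(\<Sum>j\<in>I. norm (h j x)) = N x" for x
    by (simp add: I_def h_def N_def sum.reindex image_iff)
  have "\<forall>\<^sub>F x in nhds x0. \<forall>i\<in>I. h i x = 0"
  proof (rule vanish_of_linear_differential_inequality[where K = C])
    show "finite I" by (simp add: I_def)
    show "h i x0 = 0" if "i \<in> I" for i by (simp add: h_def fg dfg split: option.split)
    have "\<forall>\<^sub>F x in nhds x0. \<forall>v\<in>Basis. \<forall>w\<in>Basis. norm (dd v (dd w f) x - dd v (dd w g) x) \<le> K v w * N x"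
      using K by (simp add: eventually_ball_finite)
    then show "\<forall>\<^sub>F x in nhds x0. \<forall>i\<in>I. h i differentiable (at x) \<and>
      (\<forall>w. norm (dd w (h i) x) \<le> C * (\<Sum>j\<in>I. norm (h j x)) * norm w)"
      using in\<Omega>
    proof eventually_elim
      case (elim x)
      have C1: "C \<ge> 1" by (simp add: C_def sum_nonneg)
      have "h None = (\<lambda>x. f x - g x)" by (simp add: h_def fun_eq_iff)
      then have der0: "(h None has_derivative (\<lambda>w. dd w f x - dd w g x)) (at x)"
        using elim(2) by (auto intro!: has_derivative_diff has_derivative_dd f.diff_f g.diff_f)
      have "h (Some b) = (\<lambda>x. dd b f x - dd b g x)" for b by (simp add: h_def fun_eq_iff)
      then have der1: "(h (Some b) has_derivative (\<lambda>w. dd w (dd b f) x - dd w (dd b g) x)) (at x)" for b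
        using elim(2) by (auto intro!: has_derivative_diff has_derivative_dd f.diff_df g.diff_df)
      have "norm (dd w (h None) x) \<le> C * N x * norm w" for w
      proof -
        have "N x * norm w \<le> C * N x * norm w"
          using C1 N0[of x] by (intro mult_right_mono) (auto simp: mult_le_cancel_right1)
        then show ?thesis using Nd[OF elim(2), of w] dd_eqI[OF der0, of w] by simp
      qed
      moreover have "norm (dd w (h (Some b)) x) \<le> C * N x * norm w" if b: "b \<in> Basis" for w b
      proof -
        have "linear (\<lambda>w. dd w (dd b f) x - dd w (dd b g) x)"
          using der1 has_derivative_linear by blast
        from norm_linear_le_Basis[OF this, of w]
        have "norm (dd w (dd b f) x - dd w (dd b g) x)
          \<le> (\<Sum>v\<in>Basis. norm (dd v (dd b f) x - dd v (dd b g) x)) * norm w" .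
        also have "\<dots> \<le> (\<Sum>v\<in>Basis. \<bar>K v b\<bar> * N x) * norm w"
        proof (intro mult_right_mono sum_mono)
          fix v :: 'e assume "v \<in> Basis"
          with elim(1) b have "norm (dd v (dd b f) x - dd v (dd b g) x) \<le> K v b * N x" by blast
          also have "\<dots> \<le> \<bar>K v b\<bar> * N x" using N0 by (intro mult_right_mono) auto
          finally show "norm (dd v (dd b f) x - dd v (dd b g) x) \<le> \<bar>K v b\<bar> * N x" .
        qed simp
        also have "\<dots> = (\<Sum>v\<in>Basis. \<bar>K v b\<bar>) * N x * norm w" by (simp add: sum_distrib_right)
        also have "\<dots> \<le> C * N x * norm w"
        proof -
          have "(\<Sum>v\<in>Basis. \<bar>K v b\<bar>) \<le> (\<Sum>w\<in>Basis. \<Sum>v\<in>Basis. \<bar>K v w\<bar>)"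
            using b by (intro member_le_sum) (auto simp: sum_nonneg)
          then have "(\<Sum>v\<in>Basis. \<bar>K v b\<bar>) \<le> C" by (simp add: C_def)
          then show ?thesis by (intro mult_right_mono N0 norm_ge_zero)
        qed
        finally show ?thesis using dd_eqI[OF der1[of b], of w] by simp
      qed
      moreover have "h None differentiable (at x)" "h (Some b) differentiable (at x)" for b
        using der0 der1[of b] unfolding differentiable_def by blast+
      moreover have "i = None \<or> (\<exists>b\<in>Basis. i = Some b)" if "i \<in> I" for i
        using that by (auto simp: I_def)
      ultimately show ?case unfolding sumI by blast
    qed
  qed
  then show ?thesis by eventually_elim (simp add: I_def h_def)
qed

lemma local_isometry_subset:
  assumes "local_isometry W W' L L' \<Omega> f" and "open \<Omega>'" "\<Omega>' \<subseteq> \<Omega>"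
  shows "local_isometry W W' L L' \<Omega>' f"
proof -
  interpret local_isometry W W' L L' \<Omega> f by (rule assms(1))
  show ?thesis
  proof
    show "regular_Lagrangian W L" "regular_Lagrangian W' L'" "open \<Omega>'" by (fact L L' assms(2))+
    show "Ck_on 2 \<Omega>' f" by (rule Ck_on_subset[OF C2 assms(3)])
    fix x assume "x \<in> \<Omega>'"
    then have x: "x \<in> \<Omega>" using assms(3) by blast
    show "surj (\<lambda>v. dd v f x)" by (rule surj[OF x])
    show "\<exists>y. (x, y) \<in> W" by (rule nonempty[OF x])
    fix y assume "(x, y) \<in> W"
    with x show "(f x, dd y f x) \<in> W'" "L' (f x, dd y f x) = L (x, y)"
      by (rule maps, rule preserves)
  qed
qed

section \<open>Pseudo-Finsler manifolds in charts\<close>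

lemma dd_fibre:
  assumes "L differentiable (at (x, y))"
  shows "dd a (\<lambda>y. L (x, y)) y = dd (0, a) L (x, y)"
proof -
  have "((\<lambda>y. (x, y)) has_derivative (\<lambda>v. (0, v))) (at y)"
    by (intro has_derivative_Pair has_derivative_const has_derivative_ident)
  from dd_eqI[OF has_derivative_compose[OF this has_derivative_dd[OF assms]]] show ?thesis .
qed

locale pseudo_finsler_manifold =
  fixes X :: "'a topology" and A :: "('a, 'e::euclidean_space) chart set"
    and T :: "('a, 'e) tangent set" and F :: "('a, 'e) tangent \<Rightarrow> real"
  assumes manifold: "smooth_manifold X A" and finsler: "pseudo_finsler A T F"
begin

lemma topspace_eq: "topspace X = (\<Union>c\<in>A. dom_chart c)"
  using manifold by (simp add: smooth_manifold_def)

lemma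
  assumes "c \<in> A"
  shows openin_dom: "openin X (dom_chart c)" and open_range: "open (app_chart c ` dom_chart c)"
    and homeo: "homeomorphic_map (subtopology X (dom_chart c)) (top_of_set (app_chart c ` dom_chart c)) (app_chart c)"
  using manifold assms by (auto simp: smooth_manifold_def)

lemma dom_subset: "c \<in> A \<Longrightarrow> dom_chart c \<subseteq> topspace X"
  using openin_dom openin_subset by blast

lemma inj_chart: "c \<in> A \<Longrightarrow> inj_on (app_chart c) (dom_chart c)"
  using homeo[of c] dom_subset[of c] by (simp add: homeomorphic_map_def Int_absorb1)

lemma inv_chart_app: "c \<in> A \<Longrightarrow> p \<in> dom_chart c \<Longrightarrow> inv_chart c (app_chart c p) = p"
  by (simp add: inv_chart_def inj_chart)

lemma coord_rep_app: "c \<in> A \<Longrightarrow> p \<in> dom_chart c \<Longrightarrow> coord_rep c d f (app_chart c p) = app_chart d (f p)"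
  by (simp add: coord_rep_def inv_chart_app)

lemma open_chart_image:
  assumes c: "c \<in> A" and O: "openin X U"
  shows "open (app_chart c ` (U \<inter> dom_chart c))"
proof -
  have "openin (subtopology X (dom_chart c)) (U \<inter> dom_chart c)"
    using O by (auto simp: openin_subtopology)
  then have "openin (top_of_set (app_chart c ` dom_chart c)) (app_chart c ` (U \<inter> dom_chart c))"
    using homeomorphic_imp_open_map[OF homeo[OF c]] by (simp add: open_map_def)
  then show ?thesis using open_range[OF c] openin_open_trans by blast
qed

lemma open_chart_preimage:
  assumes c: "c \<in> A" and V: "open V"
  shows "openin X {p \<in> dom_chart c. app_chart c p \<in> V}"
proof -
  have "continuous_map (subtopology X (dom_chart c)) (top_of_set (app_chart c ` dom_chart c)) (app_chart c)"
    using homeomorphic_imp_continuous_map[OF homeo[OF c]] .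
  then have "continuous_map (subtopology X (dom_chart c)) euclidean (app_chart c)"
    by (simp add: continuous_map_in_subtopology)
  then have "openin (subtopology X (dom_chart c)) {p \<in> topspace (subtopology X (dom_chart c)). app_chart c p \<in> V}"
    using V by (simp add: continuous_map_def)
  moreover have "topspace (subtopology X (dom_chart c)) = dom_chart c"
    using dom_subset[OF c] by auto
  ultimately have "openin (subtopology X (dom_chart c)) {p \<in> dom_chart c. app_chart c p \<in> V}"
    by (simp only:)
  then show ?thesis by (rule openin_trans_full[OF _ openin_dom[OF c]])
qed

text \<open>The coordinate expression of the Lagrangian F^2, and the set of coordinates of admissible vectors. Outside this
  set the values of \<open>energy\<close> are arbitrary.\<close>

definition energy_dom :: "('a, 'e) chart \<Rightarrow> ('e \<times> 'e) set" where
  "energy_dom c = app_chart (tangent_chart A c) ` (T \<inter> dom_chart (tangent_chart A c))"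

definition energy :: "('a, 'e) chart \<Rightarrow> 'e \<times> 'e \<Rightarrow> real" where
  "energy c z = (F (inv_chart (tangent_chart A c) z))\<^sup>2"

lemma T_tangent: "w \<in> T \<Longrightarrow> w \<in> tangent_bundle A"
  using finsler by (auto simp: pseudo_finsler_def slit_tangent_bundle_def)

lemma tangent_chart_mem: "w \<in> T \<Longrightarrow> w \<in> dom_chart (tangent_chart A c) \<longleftrightarrow> fst w \<in> dom_chart c"
  using T_tangent by (auto simp: tangent_chart_def)

lemma tangent_chart_app: "app_chart (tangent_chart A c) w = (app_chart c (fst w), snd w c)"
  by (simp add: tangent_chart_def)

lemma energy_domI: "w \<in> T \<Longrightarrow> fst w \<in> dom_chart c \<Longrightarrow> (app_chart c (fst w), snd w c) \<in> energy_dom c"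
  using tangent_chart_mem tangent_chart_app unfolding energy_dom_def by (metis IntI imageI)

lemma energy_domE:
  assumes "z \<in> energy_dom c"
  obtains w where "w \<in> T" "fst w \<in> dom_chart c" "z = (app_chart c (fst w), snd w c)"
proof -
  obtain w where "w \<in> T" "w \<in> dom_chart (tangent_chart A c)" "z = app_chart (tangent_chart A c) w"
    using assms unfolding energy_dom_def by blast
  then show ?thesis using that[of w] tangent_chart_mem[of w c] by (simp add: tangent_chart_app)
qed

lemma energy_app:
  assumes c: "c \<in> A" and w: "w \<in> T" "fst w \<in> dom_chart c"
  shows "energy c (app_chart c (fst w), snd w c) = (F w)\<^sup>2"
proof -
  have "inv_chart (tangent_chart A c) (app_chart (tangent_chart A c) w) = w"
    unfolding inv_chart_def
    by (rule inv_into_f_f[OF inj_on_tangent_chart[OF inj_chart[OF c] c]]) (simp add: tangent_chart_mem w)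
  then show ?thesis by (simp add: energy_def tangent_chart_app)
qed

lemma regular_energy:
  assumes c: "c \<in> A"
  shows "regular_Lagrangian (energy_dom c) (energy c)"
proof -
  have op: "open (energy_dom c)"
    using finsler openin_tangent_topology[OF manifold] c by (simp add: pseudo_finsler_def energy_dom_def)
  have "smooth_on (energy_dom c) (F \<circ> inv_chart (tangent_chart A c))"
    using finsler c by (simp add: pseudo_finsler_def smooth_function_on_def tangent_atlas_def energy_dom_def)
  then have sm: "smooth_on (energy_dom c) (energy c)"
    unfolding smooth_on_def energy_def power2_eq_square o_def
    by (auto intro: Ck_on_bilinear[OF bounded_bilinear_mult op])
  have "u = 0" if z: "z \<in> energy_dom c" and u: "\<forall>a. dd (0, u) (dd (0, a) (energy c)) z = 0" for z u
  proof -
    obtain w where w: "w \<in> T" "fst w \<in> dom_chart c" "z = (app_chart c (fst w), snd w c)"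
      using energy_domE[OF z] .
    let ?x = "app_chart c (fst w)"
    have slice: "open {y. (?x, y) \<in> energy_dom c}"
    proof -
      have "open (Pair ?x -` energy_dom c)" by (intro open_vimage op continuous_intros)
      then show ?thesis by (simp add: vimage_def)
    qed
    have "fundamental_tensor A F c w a b = dd (0, a) (dd (0, b) (energy c)) z" for a b
    proof -
      have "fundamental_tensor A F c w a b = dd a (\<lambda>y. dd b (\<lambda>y. energy c (?x, y)) y) (snd w c)"
        by (simp add: fundamental_tensor_def energy_def)
      also have "\<dots> = dd a (\<lambda>y. dd (0, b) (energy c) (?x, y)) (snd w c)"
        using z w(3) by (intro dd_cong_open[OF slice] dd_fibre smooth_on_differentiable[OF sm]) simp_all
      also have "\<dots> = dd (0, a) (dd (0, b) (energy c)) z"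
        unfolding w(3) by (rule dd_fibre[OF smooth_on_differentiable[OF smooth_on_dd[OF sm]]]) (use z w(3) in simp)
      finally show ?thesis .
    qed
    moreover have "nondegenerate_symmetric_bilinear (fundamental_tensor A F c w)"
      using finsler w c by (simp add: pseudo_finsler_def)
    ultimately show ?thesis using u by (simp add: nondegenerate_symmetric_bilinear_def)
  qed
  then show ?thesis using op sm by (simp add: regular_Lagrangian_def)
qed

definition rep_dom :: "('a, 'e) chart \<Rightarrow> ('a, 'e) chart \<Rightarrow> ('a \<Rightarrow> 'a) \<Rightarrow> 'e set" where
  "rep_dom c d f = app_chart c ` (dom_chart c \<inter> f -` dom_chart d)"

lemma rep_dom_app: "c \<in> A \<Longrightarrow> p \<in> dom_chart c \<Longrightarrow> app_chart c p \<in> rep_dom c d f \<longleftrightarrow> f p \<in> dom_chart d"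
  unfolding rep_dom_def using inj_on_image_mem_iff[OF inj_chart, of c p "dom_chart c \<inter> f -` dom_chart d"] by simp

lemma open_rep_dom:
  assumes "c \<in> A" "d \<in> A" "continuous_map X X f"
  shows "open (rep_dom c d f)"
proof -
  have "openin X {p \<in> topspace X. f p \<in> dom_chart d}"
    using assms(3) openin_dom[OF assms(2)] by (simp add: continuous_map_def)
  moreover have "dom_chart c \<inter> f -` dom_chart d = {p \<in> topspace X. f p \<in> dom_chart d} \<inter> dom_chart c"
    using dom_subset[OF assms(1)] by auto
  ultimately show ?thesis using open_chart_image[OF assms(1)] by (simp add: rep_dom_def)
qed

text \<open>The definition of \<open>tangent_map\<close> picks a chart around the base point; compatibility of the
  coordinates of a tangent vector and the chain rule replace it by any other one.\<close>

lemma tangent_map_coords: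
  assumes f: "Ck_map 2 X A X A f" and w: "w \<in> T"
    and c: "c \<in> A" "fst w \<in> dom_chart c" and d: "d \<in> A" "f (fst w) \<in> dom_chart d"
  shows "fst (tangent_map A A f w) = f (fst w)"
    and "snd (tangent_map A A f w) d = dd (snd w c) (coord_rep c d f) (app_chart c (fst w))"
proof -
  define p where "p = fst w"
  define c' where "c' = (SOME c. c \<in> A \<and> p \<in> dom_chart c)"
  have c': "c' \<in> A" "p \<in> dom_chart c'"
    using someI[of "\<lambda>c. c \<in> A \<and> p \<in> dom_chart c" c] c by (auto simp: c'_def p_def)
  have tm: "tangent_map A A f w = (f p, \<lambda>d. if d \<in> A \<and> f p \<in> dom_chart d
      then dd (snd w c') (coord_rep c' d f) (app_chart c' p) else 0)"
    unfolding tangent_map_def Let_def p_def[symmetric] c'_def[symmetric] ..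
  then show "fst (tangent_map A A f w) = f (fst w)" by (simp add: p_def)
  let ?x = "app_chart c p" and ?\<tau> = "coord_rep c c' id"
  have V: "open (app_chart c ` (dom_chart c \<inter> dom_chart c'))"
    using open_chart_image[OF c(1) openin_dom[OF c'(1)]] by (simp add: Int_commute)
  have x: "?x \<in> app_chart c ` (dom_chart c \<inter> dom_chart c')" using c c' by (auto simp: p_def)
  have \<tau>x: "?\<tau> ?x = app_chart c' p" using coord_rep_app[OF c, of c' id] by (simp add: p_def)
  have "smooth_on (app_chart c ` (dom_chart c \<inter> dom_chart c')) ?\<tau>"
    using manifold c(1) c'(1) unfolding smooth_manifold_def by blast
  then have d\<tau>: "?\<tau> differentiable (at ?x)" using x by (rule smooth_on_differentiable)
  have "Ck_on 2 (rep_dom c' d f) (coord_rep c' d f)"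
    using f c' d by (simp add: Ck_map_def rep_dom_def)
  moreover have "app_chart c' p \<in> rep_dom c' d f"
    using rep_dom_app[OF c'] d by (simp add: p_def)
  ultimately have df: "coord_rep c' d f differentiable (at (?\<tau> ?x))"
    by (simp add: \<tau>x numeral_2_eq_2)
  have eq: "coord_rep c d f y = coord_rep c' d f (?\<tau> y)" if "y \<in> app_chart c ` (dom_chart c \<inter> dom_chart c')" for y
    using that c(1) c'(1) by (auto simp: coord_rep_app)
  have "dd (snd w c) (coord_rep c d f) ?x = dd (snd w c) (\<lambda>y. coord_rep c' d f (?\<tau> y)) ?x"
    by (rule dd_cong_open[OF V x eq])
  also have "\<dots> = dd (dd (snd w c) ?\<tau> ?x) (coord_rep c' d f) (?\<tau> ?x)"
    by (rule dd_eqI[OF has_derivative_compose[OF has_derivative_dd[OF d\<tau>] has_derivative_dd[OF df]]])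
  also have "dd (snd w c) ?\<tau> ?x = snd w c'"
  proof -
    have "u c' = dd (u c) ?\<tau> ?x" if "(p, u) \<in> tangent_bundle A" for u
      using that c c' p_def unfolding tangent_bundle_def by blast
    moreover have "(p, snd w) \<in> tangent_bundle A" using T_tangent[OF w] by (simp add: p_def)
    ultimately show ?thesis by simp
  qed
  finally have "dd (snd w c) (coord_rep c d f) ?x = dd (snd w c') (coord_rep c' d f) (app_chart c' p)"
    by (simp only: \<tau>x)
  then show "snd (tangent_map A A f w) d = dd (snd w c) (coord_rep c d f) (app_chart c (fst w))"
    using d by (simp add: tm p_def)
qed

lemma local_isometry_coord_rep:
  assumes f: "finsler_isometry X A T F f" and c: "c \<in> A" and d: "d \<in> A"
  shows "local_isometry (energy_dom c) (energy_dom d) (energy c) (energy d) (rep_dom c d f) (coord_rep c d f)"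
proof -
  define g where "g = inv_into (topspace X) f"
  have bij: "bij_betw f (topspace X) (topspace X)"
    and Cf: "Ck_map 2 X A X A f" and Cg: "Ck_map 2 X A X A g"
    and fT: "tangent_map A A f ` T = T" and fF: "\<And>w. w \<in> T \<Longrightarrow> F (tangent_map A A f w) = F w"
    using f by (auto simp: finsler_isometry_def Ck_diffeomorphism_def g_def)
  have op: "open (rep_dom c d f)"
    using open_rep_dom[OF c d] Cf by (simp add: Ck_map_def)
  have C2: "Ck_on 2 (rep_dom c d f) (coord_rep c d f)"
    using Cf c d by (simp add: Ck_map_def rep_dom_def)
  have lift: "(coord_rep c d f x, dd y (coord_rep c d f) x) \<in> energy_dom d \<and>
      energy d (coord_rep c d f x, dd y (coord_rep c d f) x) = energy c (x, y)"
    if x: "x \<in> rep_dom c d f" and xy: "(x, y) \<in> energy_dom c" for x y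
  proof -
    obtain w where w: "w \<in> T" "fst w \<in> dom_chart c" "x = app_chart c (fst w)" "y = snd w c"
      using energy_domE[OF xy] by blast
    have fw: "f (fst w) \<in> dom_chart d" using x rep_dom_app[OF c w(2)] w(3) by simp
    define w' where "w' = tangent_map A A f w"
    have w': "w' \<in> T" using fT w(1) by (auto simp: w'_def)
    have coords: "fst w' = f (fst w)" "snd w' d = dd y (coord_rep c d f) x"
      using tangent_map_coords[OF Cf w(1) c w(2) d fw] w by (simp_all add: w'_def)
    have "(coord_rep c d f x, dd y (coord_rep c d f) x) = (app_chart d (fst w'), snd w' d)"
      using coords w(2,3) c by (simp add: coord_rep_app)
    moreover have "energy d (app_chart d (fst w'), snd w' d) = energy c (x, y)"
      using energy_app[OF d w'] energy_app[OF c w(1,2)] fF[OF w(1)] fw coords w by (simp add: w'_def)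
    moreover have "(app_chart d (fst w'), snd w' d) \<in> energy_dom d"
      by (rule energy_domI[OF w']) (simp add: coords(1) fw)
    ultimately show ?thesis by simp
  qed
  show ?thesis
  proof
    show "regular_Lagrangian (energy_dom c) (energy c)" "regular_Lagrangian (energy_dom d) (energy d)"
      by (intro regular_energy c d)+
    show "open (rep_dom c d f)" "Ck_on 2 (rep_dom c d f) (coord_rep c d f)" by fact+
    fix x assume x: "x \<in> rep_dom c d f"
    then obtain q where q: "q \<in> dom_chart c" "f q \<in> dom_chart d" "x = app_chart c q"
      by (auto simp: rep_dom_def)
    have "\<exists>w\<in>T. fst w = q"
      using finsler c q(1) unfolding pseudo_finsler_def by simp
    then show "\<exists>y. (x, y) \<in> energy_dom c" using energy_domI[of _ c] q by auto
    have df: "coord_rep c d f differentiable (at x)" using C2 x by (simp add: numeral_2_eq_2)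
    have gf: "g (f p) = p" if "p \<in> dom_chart c" for p
      using inv_into_f_f[OF bij_betw_imp_inj_on[OF bij]] dom_subset[OF c] that by (auto simp: g_def)
    have fx: "coord_rep c d f x = app_chart d (f q)" using q c by (simp add: coord_rep_app)
    have "Ck_on 2 (rep_dom d c g) (coord_rep d c g)" using Cg c d by (simp add: Ck_map_def rep_dom_def)
    moreover have "app_chart d (f q) \<in> rep_dom d c g" using rep_dom_app[OF d q(2)] gf[OF q(1)] q(1) by simp
    ultimately have dg: "coord_rep d c g differentiable (at (coord_rep c d f x))"
      by (simp add: numeral_2_eq_2 fx)
    have "coord_rep d c g (coord_rep c d f y) = y" if "y \<in> rep_dom c d f" for y
      using that c d gf by (auto simp: rep_dom_def coord_rep_app)
    from dd_cong_open[OF op x this]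
    have "dd v (\<lambda>y. coord_rep d c g (coord_rep c d f y)) x = v" for v by simp
    moreover have "dd v (\<lambda>y. coord_rep d c g (coord_rep c d f y)) x
        = dd (dd v (coord_rep c d f) x) (coord_rep d c g) (coord_rep c d f x)" for v
      by (rule dd_eqI[OF has_derivative_compose[OF has_derivative_dd[OF df] has_derivative_dd[OF dg]]])
    ultimately have "inj (\<lambda>v. dd v (coord_rep c d f) x)" by (metis injI)
    then show "surj (\<lambda>v. dd v (coord_rep c d f) x)"
      by (simp add: linear_injective_imp_surjective linear_dd[OF df])
  next
    fix x y assume "x \<in> rep_dom c d f" "(x, y) \<in> energy_dom c"
    from lift[OF this] show "(coord_rep c d f x, dd y (coord_rep c d f) x) \<in> energy_dom d"
      "energy d (coord_rep c d f x, dd y (coord_rep c d f) x) = energy c (x, y)" by simp_all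
  qed
qed

lemma isometry_continuous: "finsler_isometry X A T F f \<Longrightarrow> continuous_map X X f"
  by (simp add: finsler_isometry_def Ck_diffeomorphism_def Ck_map_def)

lemma isometry_smooth:
  assumes f: "finsler_isometry X A T F f"
  shows "smooth_map X A X A f"
  using local_isometry.smooth_on_isometry[OF local_isometry_coord_rep[OF f]] isometry_continuous[OF f]
  by (simp add: smooth_map_def Ck_map_def smooth_on_def rep_dom_def)

lemma isometries_agree_near:
  assumes f: "finsler_isometry X A T F f" and g: "finsler_isometry X A T F g"
    and c: "c \<in> A" "q \<in> dom_chart c" and d: "d \<in> A" "f q \<in> dom_chart d"
    and fg: "f q = g q"
    and dfg: "\<And>v. dd v (coord_rep c d f) (app_chart c q) = dd v (coord_rep c d g) (app_chart c q)"
  shows "\<exists>U. openin X U \<and> q \<in> U \<and> (\<forall>p\<in>U. f p = g p)"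
proof -
  let ?\<Omega> = "rep_dom c d f \<inter> rep_dom c d g"
  have op: "open ?\<Omega>" by (intro open_Int open_rep_dom c d isometry_continuous f g)
  have x0: "app_chart c q \<in> ?\<Omega>" using rep_dom_app[OF c] d fg by simp
  have "\<forall>\<^sub>F x in nhds (app_chart c q). coord_rep c d f x = coord_rep c d g x"
    by (rule local_isometry_unique[OF local_isometry_subset[OF local_isometry_coord_rep[OF f c(1) d(1)] op]
          local_isometry_subset[OF local_isometry_coord_rep[OF g c(1) d(1)] op] x0 _ dfg])
      (use c fg in \<open>auto simp: coord_rep_app\<close>)
  then obtain V where V: "open V" "app_chart c q \<in> V" "\<And>x. x \<in> V \<Longrightarrow> coord_rep c d f x = coord_rep c d g x"
    unfolding eventually_nhds by blast
  define U where "U = {p \<in> dom_chart c. app_chart c p \<in> V \<inter> ?\<Omega>}"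
  have "openin X U" unfolding U_def by (intro open_chart_preimage c open_Int V op[unfolded open_Int])
  moreover have "q \<in> U" using c V x0 by (simp add: U_def)
  moreover have "f p = g p" if "p \<in> U" for p
  proof -
    have p: "p \<in> dom_chart c" "f p \<in> dom_chart d" "g p \<in> dom_chart d" "app_chart c p \<in> V"
      using that rep_dom_app[OF c(1), of p d f] rep_dom_app[OF c(1), of p d g] by (simp_all add: U_def)
    have "app_chart d (f p) = app_chart d (g p)" using V(3)[OF p(4)] c p(1) by (simp add: coord_rep_app)
    then show ?thesis using inj_onD[OF inj_chart[OF d(1)]] p by blast
  qed
  ultimately show ?thesis by blast
qed

text \<open>The interior of the set where f and g agree is closed: at a limit point the values agree
  because the space is Hausdorff and the first derivatives agree by continuity, so local uniqueness applies
  there. Working with the interior rather than with the set of points of equal jets avoids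
  changes of charts.\<close>

lemma isometries_equal:
  assumes conn: "connected_space X"
    and f: "finsler_isometry X A T F f" and g: "finsler_isometry X A T F g"
    and p: "p \<in> topspace X" and jet: "same_jet 2 A A p f g"
    and q: "q \<in> topspace X"
  shows "f q = g q"
proof -
  define Z where "Z = \<Union>{U. openin X U \<and> (\<forall>p\<in>U. f p = g p)}"
  have diff: "coord_rep c d h differentiable (at (app_chart c q))"
    if "finsler_isometry X A T F h" "c \<in> A" "d \<in> A" "q \<in> dom_chart c" "h q \<in> dom_chart d" for h c d q
    using local_isometry.diff_f[OF local_isometry_coord_rep[OF that(1-3)]] rep_dom_app that by simp
  have open_Z: "openin X Z" unfolding Z_def by (rule openin_Union) simp
  have "p \<in> Z"
  proof -
    obtain c d where fp: "f p = g p" and cd: "c \<in> A" "d \<in> A" "p \<in> dom_chart c" "f p \<in> dom_chart d"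
      and jets: "\<And>is. set is \<subseteq> Basis \<Longrightarrow> length is \<le> 2 \<Longrightarrow>
        iter_deriv is (coord_rep c d f) (app_chart c p) = iter_deriv is (coord_rep c d g) (app_chart c p)"
      using jet unfolding same_jet_def by blast
    have basis: "dd b (coord_rep c d f) (app_chart c p) = dd b (coord_rep c d g) (app_chart c p)" if "b \<in> Basis" for b
      using jets[of "[b]"] that by simp
    have df: "coord_rep c d f differentiable (at (app_chart c p))"
      and dg: "coord_rep c d g differentiable (at (app_chart c p))"
      using diff[OF f cd] diff[OF g cd(1-3)] cd(4) fp by simp_all
    have "dd v (coord_rep c d f) (app_chart c p) = dd v (coord_rep c d g) (app_chart c p)" for v
      unfolding dd_expand[OF df, of v] dd_expand[OF dg, of v] by (rule sum.cong) (simp_all add: basis)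
    from isometries_agree_near[OF f g cd(1,3,2,4) fp this] show ?thesis by (auto simp: Z_def)
  qed
  moreover have "closedin X Z"
  proof -
    have "q \<in> Z" if q: "q \<in> X closure_of Z" for q
    proof -
      have "Hausdorff_space X" using manifold by (simp add: smooth_manifold_def)
      then have fg: "f q = g q"
        by (rule forall_in_closure_of_eq[OF q _ isometry_continuous[OF f] isometry_continuous[OF g]])
          (auto simp: Z_def)
      have qX: "q \<in> topspace X" using q by (simp add: in_closure_of)
      then have "f q \<in> topspace X" using isometry_continuous[OF f] by (auto simp: continuous_map_def)
      with qX obtain c d where cd: "c \<in> A" "q \<in> dom_chart c" "d \<in> A" "f q \<in> dom_chart d"
        unfolding topspace_eq by blast
      let ?x = "app_chart c q" and ?\<Omega> = "rep_dom c d f \<inter> rep_dom c d g"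
      have "dd v (coord_rep c d f) ?x = dd v (coord_rep c d g) ?x" for v
      proof (rule ccontr)
        assume ne: "dd v (coord_rep c d f) ?x \<noteq> dd v (coord_rep c d g) ?x"
        have cont: "isCont (dd v (coord_rep c d h)) ?x"
          if "finsler_isometry X A T F h" "h q \<in> dom_chart d" for h
          using local_isometry.diff_df[OF local_isometry_coord_rep[OF that(1) cd(1,3)]] rep_dom_app[OF cd(1,2)] that(2)
          by (intro differentiable_imp_continuous_within) simp
        have "isCont (\<lambda>x. dd v (coord_rep c d f) x - dd v (coord_rep c d g) x) ?x"
          using cont[OF f] cont[OF g] cd(4) fg by (intro continuous_intros) simp_all
        from topological_tendstoD[OF isCont_tendsto_nhds[OF this] open_delete[OF open_UNIV, of 0]]
        have "\<forall>\<^sub>F x in nhds ?x. dd v (coord_rep c d f) x \<noteq> dd v (coord_rep c d g) x"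
          using ne by simp
        then obtain V where V: "open V" "?x \<in> V" "\<And>x. x \<in> V \<Longrightarrow> dd v (coord_rep c d f) x \<noteq> dd v (coord_rep c d g) x"
          unfolding eventually_nhds by blast
        define U where "U = {p \<in> dom_chart c. app_chart c p \<in> V}"
        have "openin X U" unfolding U_def by (rule open_chart_preimage[OF cd(1) V(1)])
        moreover have "q \<in> U" using cd(2) V(2) by (simp add: U_def)
        ultimately have "\<exists>r. r \<in> Z \<and> r \<in> U" using q unfolding in_closure_of by simp
        then obtain r where r: "r \<in> Z" "r \<in> dom_chart c" "app_chart c r \<in> V"
          unfolding U_def by auto
        have "coord_rep c d f y = coord_rep c d g y" if "y \<in> app_chart c ` (Z \<inter> dom_chart c)" for y
          using that cd(1) by (auto simp: coord_rep_app Z_def)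
        then have "dd v (coord_rep c d f) (app_chart c r) = dd v (coord_rep c d g) (app_chart c r)"
          using r(1,2) by (intro dd_cong_open[OF open_chart_image[OF cd(1) open_Z]]) simp_all
        with V(3)[OF r(3)] show False by simp
      qed
      from isometries_agree_near[OF f g cd fg this] show ?thesis by (auto simp: Z_def)
    qed
    then show ?thesis using closure_of_subset_eq[of Z X] openin_subset[OF open_Z] by blast
  qed
  ultimately have "Z = topspace X" using conn open_Z unfolding connected_space_clopen_in by blast
  then show ?thesis using q by (auto simp: Z_def)
qed

end

theorem mainTheorem2:
  fixes X :: "'a topology"
    and A :: "('a, 'e::euclidean_space) chart set"
    and T :: "('a, 'e) tangent set"
    and F :: "('a, 'e) tangent \<Rightarrow> real"
  assumes "smooth_manifold X A"
    and "connected_space X"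
    and "pseudo_finsler A T F"
  shows "(\<forall>f. finsler_isometry X A T F f \<longrightarrow> smooth_map X A X A f) \<and>
    (\<forall>f\<^sub>1 f\<^sub>2 p. finsler_isometry X A T F f\<^sub>1 \<longrightarrow> finsler_isometry X A T F f\<^sub>2 \<longrightarrow>
       p \<in> topspace X \<longrightarrow> same_jet 2 A A p f\<^sub>1 f\<^sub>2 \<longrightarrow>
       (\<forall>q\<in>topspace X. f\<^sub>1 q = f\<^sub>2 q))"
proof -
  interpret pseudo_finsler_manifold X A T F
    by unfold_locales (rule assms(1), rule assms(3))
  show ?thesis using isometry_smooth isometries_equal[OF assms(2)] by blast
qed

end
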